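(* Let $X$ be a compact Hausdorff space, $\Delta_1\subset X$ clopen, $\alpha:\Delta_1\to X$ continuous with open image $\Delta_{-1}$, $\mathcal{A}=C(X)$, and let $\delta:\mathcal{A}\to\mathcal{A}$ be the endomorphism $\delta(a)=a\circ\alpha$ on $\Delta_1$, $\delta(a)=0$ off $\Delta_1$. If $\delta$ is a monomorphism, then for any $(\pi,U,H)\in\mathrm{CovRep}(\mathcal{A},\delta)$ there exists $(\overline\pi,U,H)\in\mathrm{CovRep}(\mathcal{B},\widetilde\delta)$ such that $$\overline\pi([a_0,\dots,a_N,0,\dots])=\pi(a_0)+U^*\pi(a_1)U+\dots+U^{*N}\pi(a_N)U^N .$$
   Context: For $n\ge1$, $\Delta_n$ is the domain of $\alpha^n$; $\Delta_0=X$. For a subset $K$ of a space $Y$, $C_K(Y)$ denotes the continuous functions on $Y$ vanishing outside $K$. Covariant representation of $(\mathcal{A},\delta)$: a triple $(\pi,U,H)$ where $\pi:\mathcal{A}\to L(H)$ is a representation (not necessarily faithful) on a Hilbert space $H$ and $U\in L(H)$ is a partial isometry with initial space $\pi(C_{\Delta_{-1}}(X))H$ and final space $\pi(C_{\Delta_1}(X))H$, such that $U\pi(a)U^*=\pi(\delta(a))$ for $a\in\mathcal{A}$. $\mathrm{CovRep}(\mathcal{A},\delta)$ is the set of these. Reversible extension: adjoin to $X$ an isolated point, denoted $0$. $\widetilde X=\bigcup_{N\ge0}X_N\cup X_\infty\subset\prod_{n=0}^\infty(X\cup\{0\})$ with the topology induced from the product topology, where $X_N=\{(x_0,\dots,x_N,0,0,\dots):x_n\in\Delta_n,\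 x_N\notin\Delta_{-1},\ \alpha(x_n)=x_{n-1}\text{ for }1\le n\le N\}$ and $X_\infty=\{(x_0,x_1,\dots):x_n\in\Delta_n,\ \alpha(x_n)=x_{n-1}\text{ for }n\ge1\}$. Let $\Phi(x_0,x_1,\dots)=x_0$, $\widetilde\Delta_{\pm1}=\Phi^{-1}(\Delta_{\pm1})$ (clopen), and let $\widetilde\alpha:\widetilde\Delta_1\to\widetilde\Delta_{-1}$ be the homeomorphism $\widetilde\alpha(x_0,x_1,\dots)=(\alpha(x_0),x_0,x_1,\dots)$. Coefficient algebra: $\mathcal{B}=C(\widetilde X)$. For $a_n\in C_{\Delta_n}(X)$, $0\le n\le N$, $[a_0,\dots,a_N,0,\dots]\in\mathcal{B}$ is the function $\widetilde x=(x_0,x_1,\dots)\mapsto\sum_{n=0}^N a_n(x_n)$, with $a_n(x_n):=0$ if $x_n=0$. $\widetilde\delta:\mathcal{B}\to\mathcal{B}$ is the endomorphism $\widetilde\delta(b)=b\circ\widetilde\alpha$ on $\widetilde\Delta_1$, $0$ off $\widetilde\Delta_1$. $\mathrm{CovRep}(\mathcal{B},\widetilde\delta)$ is the set of triples $(\rho,U,H)$ where $\rho:\mathcal{B}\to L(H)$ is a representation (not necessarily faithful) on a Hilbert space $H$ and $U\in L(H)$ is a partial isometry with initial space $\rho(C_{\widetilde\Delta_{-1}}(\widetilde X))H$ and final space $\rho(C_{\widetilde\Delta_1}(\widetilde X))H$, such that $U\rho(b)U^*=\rho(\widetilde\delta(b))$ for $b\in\mathcal{B}$. *)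

theory Defs
  imports "HOL-Analysis.Analysis"
begin

section \<open>Complex Hilbert spaces and their operators\<close>

text \<open>A complex Hilbert space, given together with its underlying real Hilbert space, whose inner
  product is the real part of the complex one. The inner product \<open>cinner\<close> is linear in the
  first argument; the norm is the one of \<^class>\<open>real_inner\<close>, so that
  \<open>(norm x)\<^sup>2 = Re (cinner x x)\<close>.\<close>

class chilbert_space = real_inner + complete_space +
  fixes scaleC :: "complex \<Rightarrow> 'a \<Rightarrow> 'a"  (infixr \<open>*\<^sub>C\<close> 75)
    and cinner :: "'a \<Rightarrow> 'a \<Rightarrow> complex"
  assumes scaleC_add_right: "a *\<^sub>C (x + y) = a *\<^sub>C x + a *\<^sub>C y"
    and scaleC_add_left: "(a + b) *\<^sub>C x = a *\<^sub>C x + b *\<^sub>C x"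
    and scaleC_scaleC: "a *\<^sub>C (b *\<^sub>C x) = (a * b) *\<^sub>C x"
    and scaleC_one: "1 *\<^sub>C x = x"
    and scaleR_scaleC: "r *\<^sub>R x = complex_of_real r *\<^sub>C x"
    and cinner_commute: "cinner x y = cnj (cinner y x)"
    and cinner_add_left: "cinner (x + y) z = cinner x z + cinner y z"
    and cinner_scaleC_left: "cinner (a *\<^sub>C x) y = a * cinner x y"
    and inner_eq_Re_cinner: "inner x y = Re (cinner x y)"

text \<open>The set \<open>L(H)\<close> of bounded complex linear operators on \<open>H\<close>, where \<open>H\<close> is the type \<open>'h\<close>.\<close>

definition bounded_ops :: "('h::chilbert_space \<Rightarrow> 'h) set" where
  "bounded_ops = {T. bounded_linear T \<and> (\<forall>c x. T (c *\<^sub>C x) = c *\<^sub>C T x)}"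

definition adj :: "('h::chilbert_space \<Rightarrow> 'h) \<Rightarrow> ('h \<Rightarrow> 'h)" where
  "adj T = (THE S. \<forall>x y. cinner (S x) y = cinner x (T y))"

definition initial_space :: "('h::chilbert_space \<Rightarrow> 'h) \<Rightarrow> 'h set" where
  "initial_space U = {x. \<forall>y. U y = 0 \<longrightarrow> cinner x y = 0}"

definition final_space :: "('h::chilbert_space \<Rightarrow> 'h) \<Rightarrow> 'h set" where
  "final_space U = range U"

definition partial_isometry :: "('h::chilbert_space \<Rightarrow> 'h) \<Rightarrow> bool" where
  "partial_isometry U \<longleftrightarrow> U \<in> bounded_ops \<and> (\<forall>x\<in>initial_space U. norm (U x) = norm x)"


section \<open>Function algebras and covariant representations\<close>

text \<open>\<open>C(Y)\<close> for a topology \<open>Y\<close>. Its elements are HOL functions on the whole type; they are made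
  unique by the value \<open>0\<close> outside of \<open>topspace Y\<close>. Sums, products, scalar multiples and complex
  conjugates are therefore pointwise, and the unit is the indicator function of \<open>topspace Y\<close>.\<close>

definition cont_fun :: "'a topology \<Rightarrow> ('a \<Rightarrow> complex) set" where
  "cont_fun Y = {f. continuous_map Y euclidean f \<and> (\<forall>y. y \<notin> topspace Y \<longrightarrow> f y = 0)}"

text \<open>\<open>C\<^sub>K(Y)\<close>.\<close>

definition cont_fun_on :: "'a set \<Rightarrow> 'a topology \<Rightarrow> ('a \<Rightarrow> complex) set" where
  "cont_fun_on K Y = {f \<in> cont_fun Y. \<forall>y \<in> topspace Y - K. f y = 0}"

text \<open>Representations are *-homomorphisms into \<open>L(H)\<close>; they need not be unital or faithful.\<close>

definition representation :: "'a topology \<Rightarrow> (('a \<Rightarrow> complex) \<Rightarrow> ('h::chilbert_space \<Rightarrow> 'h)) \<Rightarrow> bool" where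
  "representation Y \<pi> \<longleftrightarrow>
     (\<forall>a\<in>cont_fun Y. \<pi> a \<in> bounded_ops) \<and>
     (\<forall>a\<in>cont_fun Y. \<forall>b\<in>cont_fun Y. \<pi> (\<lambda>y. a y + b y) = (\<lambda>h. \<pi> a h + \<pi> b h)) \<and>
     (\<forall>c. \<forall>a\<in>cont_fun Y. \<pi> (\<lambda>y. c * a y) = (\<lambda>h. c *\<^sub>C \<pi> a h)) \<and>
     (\<forall>a\<in>cont_fun Y. \<forall>b\<in>cont_fun Y. \<pi> (\<lambda>y. a y * b y) = \<pi> a \<circ> \<pi> b) \<and>
     (\<forall>a\<in>cont_fun Y. \<pi> (\<lambda>y. cnj (a y)) = adj (\<pi> a))"

text \<open>The endomorphism of \<open>C(Y)\<close> given by a map \<open>f\<close> with domain \<open>D\<close>.\<close>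

definition endo :: "'a set \<Rightarrow> ('a \<Rightarrow> 'a) \<Rightarrow> ('a \<Rightarrow> complex) \<Rightarrow> ('a \<Rightarrow> complex)" where
  "endo D f a = (\<lambda>y. if y \<in> D then a (f y) else 0)"

text \<open>Covariant representations of \<open>(C(Y), d)\<close>, where \<open>D\<close> and \<open>E\<close> play the roles of \<open>\<Delta>\<^sub>1\<close> and of
  \<open>\<Delta>\<close> with index \<open>-1\<close>. The Hilbert space \<open>H\<close> is the type \<open>'h\<close>. For clopen \<open>K\<close> the set of all
  \<open>\<pi>(a)h\<close> with \<open>a \<in> C\<^sub>K(Y)\<close> is already a closed subspace, so no closed linear span is needed.\<close>

definition CovRep :: "'a topology \<Rightarrow> 'a set \<Rightarrow> 'a set \<Rightarrow> (('a \<Rightarrow> complex) \<Rightarrow> ('a \<Rightarrow> complex)) \<Rightarrow>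
    ((('a \<Rightarrow> complex) \<Rightarrow> ('h::chilbert_space \<Rightarrow> 'h)) \<times> ('h \<Rightarrow> 'h)) set" where
  "CovRep Y D E d = {(\<pi>, U). representation Y \<pi> \<and> partial_isometry U \<and>
     initial_space U = {\<pi> a h | a h. a \<in> cont_fun_on E Y} \<and>
     final_space U = {\<pi> a h | a h. a \<in> cont_fun_on D Y} \<and>
     (\<forall>a\<in>cont_fun Y. U \<circ> \<pi> a \<circ> adj U = \<pi> (d a))}"


section \<open>The reversible extension\<close>

text \<open>\<open>\<Delta>\<^sub>n\<close>, the domain of the \<open>n\<close>-th iterate of the partial map \<open>\<alpha>\<close> with domain \<open>D\<close>.\<close>

definition Delta :: "'a topology \<Rightarrow> 'a set \<Rightarrow> ('a \<Rightarrow> 'a) \<Rightarrow> nat \<Rightarrow> 'a set" where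
  "Delta X D \<alpha> n = {x \<in> topspace X. \<forall>k<n. (\<alpha> ^^ k) x \<in> D}"

text \<open>\<open>X \<union> {0}\<close> with \<open>0\<close> isolated; the point \<open>0\<close> is \<open>None\<close>.\<close>

definition adjoin_point :: "'a topology \<Rightarrow> 'a option topology" where
  "adjoin_point X = topology (\<lambda>W. openin X (Some -` W))"

lemma openin_adjoin_point: "openin (adjoin_point X) W \<longleftrightarrow> openin X (Some -` W)"
proof -
  have "istopology (\<lambda>W. openin X (Some -` W))"
    by (auto simp: istopology_def vimage_Union)
  then show ?thesis
    by (simp add: adjoin_point_def topology_inverse')
qed

lemma topspace_adjoin_point: "topspace (adjoin_point X) = insert None (Some ` topspace X)"
proof (rule antisym)
  have 1: "openin X (Some -` topspace (adjoin_point X))"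
    by (rule openin_adjoin_point [THEN iffD1], rule openin_topspace)
  show "topspace (adjoin_point X) \<subseteq> insert None (Some ` topspace X)"
  proof
    fix y
    assume "y \<in> topspace (adjoin_point X)"
    then show "y \<in> insert None (Some ` topspace X)"
      using openin_subset [OF 1] by (cases y) blast+
  qed
  have "Some -` insert None (Some ` topspace X) = topspace X"
    by blast
  then have "openin (adjoin_point X) (insert None (Some ` topspace X))"
    using openin_adjoin_point [of X] openin_topspace [of X] by metis
  then show "insert None (Some ` topspace X) \<subseteq> topspace (adjoin_point X)"
    by (rule openin_subset)
qed

definition X_fin :: "'a topology \<Rightarrow> 'a set \<Rightarrow> ('a \<Rightarrow> 'a) \<Rightarrow> nat \<Rightarrow> (nat \<Rightarrow> 'a option) set" where
  "X_fin X D \<alpha> N = {x. (\<forall>n\<le>N. x n \<in> Some ` Delta X D \<alpha> n) \<and> (\<forall>n>N. x n = None) \<and>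
     x N \<notin> Some ` \<alpha> ` D \<and> (\<forall>n\<in>{1..N}. map_option \<alpha> (x n) = x (n - 1))}"

definition X_inf :: "'a topology \<Rightarrow> 'a set \<Rightarrow> ('a \<Rightarrow> 'a) \<Rightarrow> (nat \<Rightarrow> 'a option) set" where
  "X_inf X D \<alpha> = {x. (\<forall>n. x n \<in> Some ` Delta X D \<alpha> n) \<and>
     (\<forall>n\<ge>1. map_option \<alpha> (x n) = x (n - 1))}"

definition X_ext :: "'a topology \<Rightarrow> 'a set \<Rightarrow> ('a \<Rightarrow> 'a) \<Rightarrow> (nat \<Rightarrow> 'a option) topology" where
  "X_ext X D \<alpha> = subtopology (product_topology (\<lambda>n. adjoin_point X) UNIV)
     ((\<Union>N. X_fin X D \<alpha> N) \<union> X_inf X D \<alpha>)"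

text \<open>\<open>\<Phi>(x\<^sub>0, x\<^sub>1, \<dots>) = x\<^sub>0\<close>, where \<open>x\<^sub>0 \<noteq> 0\<close> on the reversible extension.\<close>

definition Phi :: "(nat \<Rightarrow> 'a option) \<Rightarrow> 'a" where
  "Phi x = the (x 0)"

definition Phi_preimage :: "'a topology \<Rightarrow> 'a set \<Rightarrow> ('a \<Rightarrow> 'a) \<Rightarrow> 'a set \<Rightarrow> (nat \<Rightarrow> 'a option) set" where
  "Phi_preimage X D \<alpha> K = {x \<in> topspace (X_ext X D \<alpha>). Phi x \<in> K}"

definition alpha_ext :: "('a \<Rightarrow> 'a) \<Rightarrow> (nat \<Rightarrow> 'a option) \<Rightarrow> (nat \<Rightarrow> 'a option)" where
  "alpha_ext \<alpha> x = case_nat (map_option \<alpha> (x 0)) x"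

text \<open>The element \<open>[a\<^sub>0, \<dots>, a\<^sub>N, 0, \<dots>]\<close> of the coefficient algebra.\<close>

definition bracket :: "'a topology \<Rightarrow> 'a set \<Rightarrow> ('a \<Rightarrow> 'a) \<Rightarrow> nat \<Rightarrow> (nat \<Rightarrow> 'a \<Rightarrow> complex) \<Rightarrow>
    (nat \<Rightarrow> 'a option) \<Rightarrow> complex" where
  "bracket X D \<alpha> N a = (\<lambda>x. if x \<in> topspace (X_ext X D \<alpha>)
     then \<Sum>n\<le>N. (case x n of None \<Rightarrow> 0 | Some y \<Rightarrow> a n y) else 0)"

end

(* Injectivity of delta forces alpha to be onto, since otherwise the indicator function of the
   complement of the (clopen) image of alpha is killed. Hence every point of the reversible extension
   is an infinite sequence, the extension is the inverse limit of the clopen sets Delta n along alpha,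
   and a function a on level n equals delta a on level n + 1. Correspondingly
   U*^n pi(a) U^n = U*^(n+1) pi(delta a) U^(n+1), because U* U = pi(1). Since the projection to each
   Delta n is onto, these operators depend only on the function on the extension and define a
   contractive *-homomorphism on the algebra of all functions that depend on a single coordinate.
   That algebra is dense by a Urysohn argument, so the homomorphism extends by continuity, and
   covariance passes to the limit. *)

theory Submission
  imports Defs
begin

section \<open>Adjoints of bounded operators\<close>

text \<open>Write V for \<open>adj U\<close>. Products of operators V^n pi(a) U^n have the factor
  U^n V^n in the middle, which for n >= 1 equals the value of pi at the indicator of
  \<open>Delta X D \<alpha> n\<close>. This is why the coefficient of a level n function is required
  to be supported there: pi(a) then absorbs the factor. The same condition makes the coefficient
  unique. The representation need not be unital, so V U is only the projection pi(1). That it is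
  exactly pi(1) comes from the image of \<alpha> being all of X; it is harmless because every pi(a)
  absorbs it. Covariance at level n + 1 comes from U V^(n+1) pi(a) U^(n+1) V = (U V) V^n pi(a) U^n
  (U V), where U V is the value of the extended representation at the indicator of the domain of the
  shift. At level 0 it is the given covariance. A single coordinate suffices for the Urysohn
  argument because each coordinate determines all earlier ones, so that by compactness disjoint
  closed sets have disjoint images under some coordinate.\<close>

instance chilbert_space \<subseteq> banach ..

text \<open>Together with \<open>inner_eq_Re_cinner\<close> this recovers \<open>cinner\<close> from
  the real inner product, so that adjoints and orthogonality can be handled with
  \<open>\<bullet>\<close> alone.\<close>

lemma Im_cinner: "Im (cinner x y) = x \<bullet> (\<i> *\<^sub>C y)"
proof -
  have "cinner x (\<i> *\<^sub>C y) = - \<i> * cinner x y"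
    using cinner_commute[of x "\<i> *\<^sub>C y"] cinner_commute[of x y] by (simp add: cinner_scaleC_left)
  then show ?thesis
    by (simp add: inner_eq_Re_cinner)
qed

lemma cinner_self: "cinner x x = of_real ((norm x)\<^sup>2)"
proof (rule complex_eqI)
  have "Im (cinner x x) = - Im (cinner x x)"
    using arg_cong[OF cinner_commute[of x x], of Im] by simp
  then show "Im (cinner x x) = Im (of_real ((norm x)\<^sup>2))"
    by simp
qed (simp add: inner_eq_Re_cinner[symmetric] power2_norm_eq_inner)

lemma cinner_scaleC_right: "cinner x (c *\<^sub>C y) = cnj c * cinner x y"
  using cinner_commute[of x "c *\<^sub>C y"] cinner_commute[of x y] by (simp add: cinner_scaleC_left)

lemma norm_scaleC: "norm (c *\<^sub>C x) = cmod c * norm (x :: 'h::chilbert_space)"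
proof -
  have "complex_of_real ((norm (c *\<^sub>C x))\<^sup>2) = of_real ((cmod c * norm x)\<^sup>2)"
    by (simp only: cinner_self[symmetric] cinner_scaleC_left cinner_scaleC_right power_mult_distrib
        of_real_mult complex_norm_square mult_ac)
  then show ?thesis
    by (simp only: of_real_eq_iff) (simp add: power2_eq_iff_nonneg)
qed

lemma bounded_linear_scaleC: "bounded_linear (\<lambda>x :: 'h::chilbert_space. c *\<^sub>C x)"
  by (rule bounded_linear_intro[where K = "cmod c"])
    (simp_all add: scaleC_add_right scaleR_scaleC scaleC_scaleC mult.commute norm_scaleC)

lemma scaleC_zero: "c *\<^sub>C 0 = (0 :: 'h::chilbert_space)"
  by (rule linear_simps(3)[OF bounded_linear_scaleC])

lemma inner_scaleC_left: "(c *\<^sub>C x) \<bullet> y = x \<bullet> (cnj c *\<^sub>C (y :: 'h::chilbert_space))"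
  by (simp add: inner_eq_Re_cinner cinner_scaleC_left cinner_scaleC_right)

lemma bounded_ops_add: "T \<in> bounded_ops \<Longrightarrow> T (x + y) = T x + T y"
  and bounded_ops_diff: "T \<in> bounded_ops \<Longrightarrow> T (x - y) = T x - T y"
  and bounded_ops_scaleC: "T \<in> bounded_ops \<Longrightarrow> T (c *\<^sub>C x) = c *\<^sub>C T x"
  and bounded_ops_bl: "T \<in> bounded_ops \<Longrightarrow> bounded_linear T"
  by (auto simp: bounded_ops_def linear_simps)

lemma bounded_opsI:
  fixes T :: "'h::chilbert_space \<Rightarrow> 'h"
  assumes "\<And>x y. T (x + y) = T x + T y" "\<And>c x. T (c *\<^sub>C x) = c *\<^sub>C T x"
    and "\<And>x. norm (T x) \<le> norm x * K"
  shows "T \<in> bounded_ops"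
  unfolding bounded_ops_def
  using assms by (auto intro!: bounded_linear_intro[where K = K] simp: scaleR_scaleC)

lemma bounded_ops_comp: "S \<in> bounded_ops \<Longrightarrow> T \<in> bounded_ops \<Longrightarrow> (\<lambda>x. S (T x)) \<in> bounded_ops"
  unfolding bounded_ops_def using bounded_linear_compose by auto

lemma bounded_ops_funpow: "T \<in> bounded_ops \<Longrightarrow> T ^^ n \<in> bounded_ops"
proof (induction n)
  case 0
  then show ?case
    by (auto simp: bounded_ops_def id_def)
next
  case (Suc n)
  then show ?case
    using bounded_ops_comp[of T "T ^^ n"] by (simp add: comp_def)
qed

text \<open>The representing vector minimises \<open>\<parallel>x\<parallel>\<^sup>2 - 2 f x\<close>; by the parallelogram law minimising sequences
  are Cauchy.\<close>

lemma Riesz_representation: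
  fixes f :: "'a::{real_inner, complete_space} \<Rightarrow> real"
  assumes f: "bounded_linear f"
  shows "\<exists>y. \<forall>x. f x = y \<bullet> x"
proof -
  interpret f: bounded_linear f by (rule f)
  define \<phi> where "\<phi> x = (norm x)\<^sup>2 - 2 * f x" for x
  obtain K where K: "\<And>x. norm (f x) \<le> norm x * K"
    using f.bounded by blast
  have low: "- K\<^sup>2 \<le> \<phi> x" for x
  proof -
    have "0 \<le> (norm x - K)\<^sup>2" by simp
    with K[of x] show ?thesis
      unfolding \<phi>_def power2_diff by (auto simp: algebra_simps)
  qed
  define m where "m = Inf (range \<phi>)"
  have m: "m \<le> \<phi> x" for x
    unfolding m_def by (rule cInf_lower) (use low in \<open>auto intro!: bdd_belowI\<close>)
  have "\<exists>x. \<phi> x < m + 1 / real (Suc n)" for n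
    using cInf_lessD[of "range \<phi>" "m + 1 / real (Suc n)"] unfolding m_def by auto
  then obtain X where X: "\<And>n. \<phi> (X n) < m + 1 / real (Suc n)"
    by metis
  \<comment> \<open>The parallelogram law at the midpoint: the linear parts of \<phi>
    cancel.\<close>
  have par: "(norm (x - y))\<^sup>2 = 2 * \<phi> x + 2 * \<phi> y - 4 * \<phi> ((1/2) *\<^sub>R (x + y))" for x y
    unfolding \<phi>_def power2_norm_eq_inner
    by (simp add: inner_simps f.add f.scaleR inner_commute[of y x] field_simps)
  have Xd: "(norm (X i - X j))\<^sup>2 \<le> 4 / real (Suc N)" if "i \<ge> N" "j \<ge> N" for i j N
  proof -
    have "1 / real (Suc i) \<le> 1 / real (Suc N)" "1 / real (Suc j) \<le> 1 / real (Suc N)"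
      using that by (auto simp: field_simps)
    then show ?thesis
      using par[of "X i" "X j"] X[of i] X[of j] m[of "(1/2) *\<^sub>R (X i + X j)"] by simp
  qed
  have "Cauchy X"
  proof (rule metric_CauchyI)
    fix e :: real assume "0 < e"
    then obtain N where N: "4 / real (Suc N) < e\<^sup>2"
      using reals_Archimedean[of "e\<^sup>2 / 4"] by (auto simp: field_simps)
    have "dist (X i) (X j) < e" if "i \<ge> N" "j \<ge> N" for i j
    proof -
      have "(norm (X i - X j))\<^sup>2 < e\<^sup>2"
        using Xd[OF that] N by simp
      then show ?thesis
        using \<open>0 < e\<close> by (simp add: dist_norm power2_less_imp_less)
    qed
    then show "\<exists>M. \<forall>i\<ge>M. \<forall>j\<ge>M. dist (X i) (X j) < e"
      by blast
  qed
  then obtain y where y: "X \<longlonglongrightarrow> y"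
    using Cauchy_convergent_iff convergent_def by blast
  have "(\<lambda>n. \<phi> (X n)) \<longlonglongrightarrow> \<phi> y"
    unfolding \<phi>_def by (intro tendsto_intros f.tendsto y)
  moreover have "(\<lambda>n. m + 1 / real (Suc n)) \<longlonglongrightarrow> m + 0"
    by (intro tendsto_intros) (use LIMSEQ_inverse_real_of_nat in \<open>simp add: inverse_eq_divide\<close>)
  ultimately have "\<phi> y \<le> m + 0"
    by (rule LIMSEQ_le) (use X less_imp_le in blast)
  then have ym: "\<phi> y \<le> m"
    by simp
  have "f x = y \<bullet> x" for x
  proof (cases "x = 0")
    case True
    then show ?thesis by (simp add: f.zero)
  next
    case False
    define d where "d = f x - y \<bullet> x"
    \<comment> \<open>The minimiser of \<phi> on the line through \<open>y\<close> in direction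
      \<open>x\<close>; moving there would lower \<phi> by
      \<open>d\<^sup>2 / (x \<bullet> x)\<close>, so minimality of \<open>y\<close> forces
      \<open>d = 0\<close>.\<close>
    define t where "t = d / (x \<bullet> x)"
    have x: "x \<bullet> x > 0" using False by simp
    have "\<phi> (y + t *\<^sub>R x) = \<phi> y - 2 * t * d + t\<^sup>2 * (x \<bullet> x)"
      unfolding \<phi>_def d_def power2_norm_eq_inner
      by (simp add: inner_simps f.add f.scaleR inner_commute[of x y] power2_eq_square algebra_simps)
    also have "\<dots> = \<phi> y - d\<^sup>2 / (x \<bullet> x)"
      using x by (simp add: t_def field_simps power2_eq_square)
    finally have "d\<^sup>2 / (x \<bullet> x) \<le> 0"
      using m[of "y + t *\<^sub>R x"] ym by simp
    then have "d\<^sup>2 \<le> 0"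
      using x by (simp add: divide_le_0_iff)
    then show ?thesis by (simp add: d_def)
  qed
  then show ?thesis by blast
qed

text \<open>By \<open>Im_cinner\<close> the imaginary parts are real inner products with
  \<open>\<i> *\<^sub>C y\<close> and \<open>\<i> *\<^sub>C T y\<close>. Since \<open>T\<close>
  commutes with \<i>, the real adjoint identity at \<open>\<i> *\<^sub>C y\<close> compares
  them.\<close>

lemma cinner_eqI:
  assumes "T \<in> bounded_ops" "\<And>x y. S x \<bullet> y = x \<bullet> T y"
  shows "cinner (S x) y = cinner x (T y)"
proof (rule complex_eqI)
  show "Re (cinner (S x) y) = Re (cinner x (T y))"
    using assms(2) by (simp add: inner_eq_Re_cinner)
  show "Im (cinner (S x) y) = Im (cinner x (T y))"
    using assms by (simp add: Im_cinner bounded_ops_scaleC)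
qed

lemma adj_eqI:
  assumes T: "T \<in> bounded_ops" and S: "\<And>x y. S x \<bullet> y = x \<bullet> T y"
  shows "adj T = S"
  unfolding adj_def
proof (rule the_equality)
  show "\<forall>x y. cinner (S x) y = cinner x (T y)"
    using cinner_eqI[OF assms] by blast
  fix R assume "\<forall>x y. cinner (R x) y = cinner x (T y)"
  then have "R x \<bullet> y = S x \<bullet> y" for x y
    using S by (simp add: inner_eq_Re_cinner)
  then show "R = S"
    by (metis ext vector_eq_rdot)
qed

lemma inner_adj:
  assumes T: "T \<in> bounded_ops"
  shows "adj T x \<bullet> y = x \<bullet> T y"
proof -
  have "\<exists>z. \<forall>y. x \<bullet> T y = z \<bullet> y" for x
    by (rule Riesz_representation)
      (rule bounded_linear_compose[OF bounded_linear_inner_right bounded_ops_bl[OF T]])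
  then obtain S where "\<And>x y. S x \<bullet> y = x \<bullet> T y"
    by metis
  with adj_eqI[OF T this] show ?thesis
    by simp
qed

lemma adj_bounded_ops:
  assumes T: "T \<in> bounded_ops"
  shows "adj T \<in> bounded_ops"
proof -
  obtain K where K: "K > 0" "\<And>x. norm (T x) \<le> norm x * K"
    using bounded_linear.pos_bounded[OF bounded_ops_bl[OF T]] by blast
  note eq = vector_eq_rdot[THEN iffD1, rule_format]
  show ?thesis
  proof (rule bounded_opsI)
    show "adj T (x + y) = adj T x + adj T y" for x y
      by (rule eq) (simp add: inner_adj[OF T] inner_add_left)
    show "adj T (c *\<^sub>C x) = c *\<^sub>C adj T x" for c x
      by (rule eq) (simp add: inner_adj[OF T] inner_scaleC_left bounded_ops_scaleC[OF T])
    show "norm (adj T x) \<le> norm x * K" for x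
    proof (cases "adj T x = 0")
      case False
      have "norm (adj T x) * norm (adj T x) = x \<bullet> T (adj T x)"
        using inner_adj[OF T, of x "adj T x"] by (simp add: power2_norm_eq_inner flip: power2_eq_square)
      also have "\<dots> \<le> norm x * norm (T (adj T x))"
        by (rule norm_cauchy_schwarz)
      also have "\<dots> \<le> norm x * (norm (adj T x) * K)"
        using K by (simp add: mult_left_mono)
      finally have "norm (adj T x) * norm (adj T x) \<le> (norm x * K) * norm (adj T x)"
        by (simp add: mult_ac)
      then show ?thesis
        using False by simp
    qed (use K in auto)
  qed
qed

lemma inner_adj_funpow:
  assumes T: "T \<in> bounded_ops"
  shows "(adj T ^^ n) x \<bullet> y = x \<bullet> (T ^^ n) y"
proof (induction n arbitrary: y)
  case (Suc n)
  have "(adj T ^^ Suc n) x \<bullet> y = (adj T ^^ n) x \<bullet> T y"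
    by (simp add: inner_adj[OF T])
  also have "\<dots> = x \<bullet> (T ^^ Suc n) y"
    by (simp only: Suc.IH funpow_Suc_right comp_apply)
  finally show ?case .
qed simp

lemma norm_adj_le:
  assumes U: "U \<in> bounded_ops" and le: "\<And>x. norm (U x) \<le> norm x"
  shows "norm (adj U x) \<le> norm x"
proof -
  have "norm (adj U x) * norm (adj U x) = x \<bullet> U (adj U x)"
    using inner_adj[OF U, of x "adj U x"] by (simp add: power2_norm_eq_inner flip: power2_eq_square)
  also have "\<dots> \<le> norm x * norm (U (adj U x))"
    by (rule norm_cauchy_schwarz)
  also have "\<dots> \<le> norm x * norm (adj U x)"
    by (intro mult_left_mono le) simp
  finally show ?thesis
    by (cases "adj U x = 0") simp_all
qed

lemma norm_funpow_le:
  fixes T :: "'b \<Rightarrow> 'b::real_normed_vector"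
  assumes "\<And>x. norm (T x) \<le> norm x"
  shows "norm ((T ^^ n) x) \<le> norm x"
proof (induction n)
  case (Suc n)
  then show ?case
    using order_trans[OF assms] by simp
qed simp

section \<open>Initial spaces and partial isometries\<close>

text \<open>The kernel of \<open>U\<close> is stable under multiplication by \<i>, so real
  orthogonality to it already kills the imaginary part of \<open>cinner\<close>.\<close>

lemma initial_space_eq:
  assumes U: "U \<in> bounded_ops"
  shows "initial_space U = {x. \<forall>y. U y = 0 \<longrightarrow> x \<bullet> y = 0}"
proof -
  have "cinner x y = 0" if "\<forall>y. U y = 0 \<longrightarrow> x \<bullet> y = 0" "U y = 0" for x y
  proof (rule complex_eqI)
    show "Re (cinner x y) = Re 0"
      using that by (simp add: inner_eq_Re_cinner)
    have "U (\<i> *\<^sub>C y) = 0"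
      using that by (simp add: bounded_ops_scaleC[OF U] scaleC_zero)
    then show "Im (cinner x y) = Im 0"
      using that by (simp add: Im_cinner)
  qed
  then show ?thesis
    unfolding initial_space_def by (auto simp: inner_eq_Re_cinner)
qed

text \<open>\<open>U P = U\<close> because \<open>z = U (x - P x)\<close> has \<open>adj U z\<close> in the initial space, that is, in the range of \<open>P\<close>,
  whence \<open>z \<bullet> z = adj U z \<bullet> (x - P x) = 0\<close>.\<close>

lemma partial_isometry_adj_comp:
  assumes U: "partial_isometry U" and P: "P \<in> bounded_ops"
    and idem: "\<And>x. P (P x) = P x" and sa: "\<And>x y. P x \<bullet> y = x \<bullet> P y"
    and range: "initial_space U = range P"
  shows "adj U (U x) = P x" "U (P x) = U x" "norm (U x) \<le> norm x"
proof -
  have Ub: "U \<in> bounded_ops" and iso: "\<And>x. norm (U (P x)) = norm (P x)"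
    using U range unfolding partial_isometry_def by auto
  show UP: "U (P x) = U x" for x
  proof -
    define z where "z = U (x - P x)"
    have "adj U z \<in> initial_space U"
      unfolding initial_space_eq[OF Ub] by (simp add: inner_adj[OF Ub])
    then obtain w where w: "adj U z = P w"
      using range by auto
    have "z \<bullet> z = P w \<bullet> (x - P x)"
      unfolding w[symmetric] by (simp add: inner_adj[OF Ub] z_def)
    also have "\<dots> = 0"
      by (simp add: sa bounded_ops_diff[OF P] idem)
    finally show ?thesis
      by (simp add: z_def bounded_ops_diff[OF Ub])
  qed
  have nP: "norm (U x) = norm (P x)" for x
    using iso[of x] UP[of x] by simp
  \<comment> \<open>Polarisation turns the equality of norms into an equality of inner products,
    which says that \<open>adj U\<close> after \<open>U\<close> is \<open>P\<close> after
    \<open>P\<close>, hence \<open>P\<close>.\<close>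
  have inn: "U x \<bullet> U y = P x \<bullet> P y" for x y
    using nP[of "x + y"] nP[of x] nP[of y]
    by (simp add: dot_norm bounded_ops_add[OF Ub] bounded_ops_add[OF P])
  show "adj U (U x) = P x"
    by (rule vector_eq_rdot[THEN iffD1, rule_format]) (simp add: inner_adj[OF Ub] inn sa idem)
  have "norm (P x) * norm (P x) = P x \<bullet> x"
    by (simp add: sa idem power2_norm_eq_inner flip: power2_eq_square)
  also have "\<dots> \<le> norm (P x) * norm x"
    by (rule norm_cauchy_schwarz)
  finally show "norm (U x) \<le> norm x"
    by (cases "P x = 0") (simp_all add: nP)
qed

section \<open>Representations of function algebras\<close>

lemma cont_fun_add: "a \<in> cont_fun Y \<Longrightarrow> b \<in> cont_fun Y \<Longrightarrow> (\<lambda>y. a y + b y) \<in> cont_fun Y"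
  and cont_fun_diff: "a \<in> cont_fun Y \<Longrightarrow> b \<in> cont_fun Y \<Longrightarrow> (\<lambda>y. a y - b y) \<in> cont_fun Y"
  and cont_fun_mult: "a \<in> cont_fun Y \<Longrightarrow> b \<in> cont_fun Y \<Longrightarrow> (\<lambda>y. a y * b y) \<in> cont_fun Y"
  and cont_fun_scale: "a \<in> cont_fun Y \<Longrightarrow> (\<lambda>y. c * a y) \<in> cont_fun Y"
  and cont_fun_cnj: "a \<in> cont_fun Y \<Longrightarrow> (\<lambda>y. cnj (a y)) \<in> cont_fun Y"
  unfolding cont_fun_def continuous_map_atin by (auto intro!: tendsto_intros)

lemma cont_fun_on_add: "a \<in> cont_fun_on K Y \<Longrightarrow> b \<in> cont_fun_on K Y \<Longrightarrow> (\<lambda>y. a y + b y) \<in> cont_fun_on K Y"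
  and cont_fun_on_scale: "a \<in> cont_fun_on K Y \<Longrightarrow> (\<lambda>y. c * a y) \<in> cont_fun_on K Y"
  and cont_fun_on_mult: "a \<in> cont_fun_on K Y \<Longrightarrow> b \<in> cont_fun Y \<Longrightarrow> (\<lambda>y. a y * b y) \<in> cont_fun_on K Y"
  and cont_fun_on_cnj: "a \<in> cont_fun_on K Y \<Longrightarrow> (\<lambda>y. cnj (a y)) \<in> cont_fun_on K Y"
  and cont_fun_onD: "a \<in> cont_fun_on K Y \<Longrightarrow> a \<in> cont_fun Y"
  by (auto simp: cont_fun_on_def cont_fun_add cont_fun_scale cont_fun_mult cont_fun_cnj)

lemma continuous_map_Re: "continuous_map Y euclidean f \<Longrightarrow> continuous_map Y euclideanreal (\<lambda>x. Re (f x))"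
  and continuous_map_Im: "continuous_map Y euclidean f \<Longrightarrow> continuous_map Y euclideanreal (\<lambda>x. Im (f x))"
  by (auto simp: continuous_map_atin intro!: tendsto_intros)

text \<open>A clopen set has empty frontier, so the two pieces can be glued without any
  compatibility condition.\<close>

lemma continuous_map_cases_clopen:
  assumes D: "openin Y D" "closedin Y D"
    and f: "continuous_map (subtopology Y D) Z f" and g: "continuous_map (subtopology Y (- D)) Z g"
  shows "continuous_map Y Z (\<lambda>y. if y \<in> D then f y else g y)"
proof (rule continuous_map_cases)
  have DS: "D \<subseteq> topspace Y"
    using D(1) by (rule openin_subset)
  have cD: "Y closure_of {x. x \<in> D} = D"
    using D by (simp add: closure_of_closedin)
  have "Y closure_of {x. x \<notin> D} = Y closure_of (topspace Y - D)"
    by (subst closure_of_restrict) (simp add: set_diff_eq Collect_conj_eq)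
  also have "\<dots> = topspace Y - D"
    using D by (intro closure_of_closedin) blast
  finally have cC: "Y closure_of {x. x \<notin> D} = topspace Y - D" .
  show "continuous_map (subtopology Y (Y closure_of {x. x \<in> D})) Z f"
    using f cD by simp
  have "subtopology Y (- D) = subtopology Y (topspace Y - D)"
    using subtopology_restrict[of Y "- D"] by (simp add: Diff_eq)
  then show "continuous_map (subtopology Y (Y closure_of {x. x \<notin> D})) Z g"
    using g cC by simp
  show "f x = g x" if "x \<in> Y frontier_of {x. x \<in> D}" for x
    using that D by (simp add: frontier_of_def closure_of_closedin interior_of_openin)
qed

lemma indicator_cont_fun:
  assumes "openin Y K" "closedin Y K"
  shows "(\<lambda>y. if y \<in> K then 1 else 0) \<in> cont_fun_on K Y"
  using continuous_map_cases_clopen[OF assms, of euclidean "\<lambda>_. 1 :: complex" "\<lambda>_. 0"]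
    openin_subset[OF assms(1)]
  by (auto simp: cont_fun_on_def cont_fun_def)

lemma endo_cont_fun:
  assumes "openin Y D" "closedin Y D" "continuous_map (subtopology Y D) Y f" "a \<in> cont_fun Y"
  shows "endo D f a \<in> cont_fun Y"
proof -
  have "continuous_map (subtopology Y D) euclidean (a \<circ> f)"
    using assms continuous_map_compose unfolding cont_fun_def by blast
  then have "continuous_map Y euclidean (\<lambda>y. if y \<in> D then (a \<circ> f) y else 0)"
    by (intro continuous_map_cases_clopen assms(1,2)) (simp_all only: continuous_map_const, simp)
  then show ?thesis
    using openin_subset[OF assms(1)] unfolding cont_fun_def endo_def comp_def by auto
qed

lemma cont_fun_bounded:
  assumes "compact_space Y" "f \<in> cont_fun Y"
  obtains M where "M > 0" "\<And>y. cmod (f y) \<le> M"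
proof -
  have "compactin euclidean (f ` topspace Y)"
    using assms image_compactin unfolding cont_fun_def compact_space_def by blast
  then obtain M where M: "M > 0" "\<And>y. y \<in> topspace Y \<Longrightarrow> cmod (f y) \<le> M"
    using compact_imp_bounded bounded_pos by (metis compactin_euclidean_iff image_eqI)
  have "cmod (f y) \<le> M" for y
    using M assms(2) by (cases "y \<in> topspace Y") (auto simp: cont_fun_def)
  with M(1) that show thesis by blast
qed

lemma
  assumes "representation Y \<pi>"
  shows rep_bounded_ops: "a \<in> cont_fun Y \<Longrightarrow> \<pi> a \<in> bounded_ops"
    and rep_add: "a \<in> cont_fun Y \<Longrightarrow> b \<in> cont_fun Y \<Longrightarrow> \<pi> (\<lambda>y. a y + b y) h = \<pi> a h + \<pi> b h"
    and rep_scale: "a \<in> cont_fun Y \<Longrightarrow> \<pi> (\<lambda>y. c * a y) h = c *\<^sub>C \<pi> a h"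
    and rep_mult: "a \<in> cont_fun Y \<Longrightarrow> b \<in> cont_fun Y \<Longrightarrow> \<pi> (\<lambda>y. a y * b y) h = \<pi> a (\<pi> b h)"
    and rep_adj: "a \<in> cont_fun Y \<Longrightarrow> \<pi> (\<lambda>y. cnj (a y)) = adj (\<pi> a)"
  using assms by (auto simp: representation_def)

lemma scaleC_minus_one: "(- 1) *\<^sub>C x = - (x :: 'h::chilbert_space)"
  using scaleR_scaleC[of "- 1" x] by simp

lemma rep_diff:
  assumes "representation Y \<pi>" "a \<in> cont_fun Y" "b \<in> cont_fun Y"
  shows "\<pi> (\<lambda>y. a y - b y) h = \<pi> a h - \<pi> b h"
  using rep_add[OF assms(1,2) cont_fun_scale[OF assms(3), of "- 1"], of h]
    rep_scale[OF assms(1,3), of "- 1" h]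
  by (simp add: scaleC_minus_one)

text \<open>With \<open>c = sqrt (s\<^sup>2 - \<bar>a\<bar>\<^sup>2)\<close> one has \<open>\<parallel>\<pi>(a)h\<parallel>\<^sup>2 + \<parallel>\<pi>(c)h\<parallel>\<^sup>2 = \<parallel>\<pi>(s1)h\<parallel>\<^sup>2\<close>, and
  \<open>\<pi>(1)\<close> is a projection.\<close>

lemma rep_contractive:
  assumes \<pi>: "representation Y \<pi>" and a: "a \<in> cont_fun Y" and s: "\<And>y. cmod (a y) \<le> s"
  shows "norm (\<pi> a h) \<le> s * norm h"
proof -
  have s0: "s \<ge> 0"
    using s[of undefined] norm_ge_zero order_trans by blast
  define e where "e = (\<lambda>y. if y \<in> topspace Y then 1 else 0 :: complex)"
  define c where "c = (\<lambda>y. if y \<in> topspace Y then complex_of_real (sqrt (s\<^sup>2 - (cmod (a y))\<^sup>2)) else 0)"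
  have e: "e \<in> cont_fun Y"
    using indicator_cont_fun[of Y "topspace Y"] by (simp add: cont_fun_on_def e_def)
  have "continuous_map Y euclidean (\<lambda>y. complex_of_real (sqrt (s\<^sup>2 - (cmod (a y))\<^sup>2)))"
    using a unfolding cont_fun_def continuous_map_atin by (auto intro!: tendsto_intros)
  then have c: "c \<in> cont_fun Y"
    unfolding cont_fun_def c_def by (auto intro: continuous_map_eq)
  have nrm: "(norm (\<pi> b h))\<^sup>2 = \<pi> (\<lambda>y. cnj (b y) * b y) h \<bullet> h" if "b \<in> cont_fun Y" for b
    using inner_adj[OF rep_bounded_ops[OF \<pi> that], of "\<pi> b h" h]
    by (simp add: rep_mult[OF \<pi> cont_fun_cnj[OF that] that] rep_adj[OF \<pi> that] power2_norm_eq_inner)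
  have ecn: "cmod (a y) * cmod (a y) \<le> s * s" for y
    using s[of y] s0 by (simp add: mult_mono)
  have "(\<lambda>y. cnj (a y) * a y + cnj (c y) * c y) = (\<lambda>y. of_real (s\<^sup>2) * e y)"
  proof
    fix y
    show "cnj (a y) * a y + cnj (c y) * c y = of_real (s\<^sup>2) * e y"
    proof (cases "y \<in> topspace Y")
      case True
      have "cnj (c y) * c y = of_real (s\<^sup>2 - (cmod (a y))\<^sup>2)"
        using True ecn[of y] by (simp add: c_def power2_eq_square flip: of_real_mult)
      moreover have "cnj (a y) * a y = of_real ((cmod (a y))\<^sup>2)"
        by (metis complex_norm_square mult.commute)
      ultimately show ?thesis
        using True by (simp add: e_def)
    qed (use a in \<open>simp add: c_def e_def cont_fun_def\<close>)
  qed
  then have "\<pi> (\<lambda>y. cnj (a y) * a y) h + \<pi> (\<lambda>y. cnj (c y) * c y) h = s\<^sup>2 *\<^sub>R \<pi> e h"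
    using rep_add[OF \<pi> cont_fun_mult[OF cont_fun_cnj[OF a] a] cont_fun_mult[OF cont_fun_cnj[OF c] c], of h]
      rep_scale[OF \<pi> e, of "of_real (s\<^sup>2)" h] by (simp add: scaleR_scaleC)
  then have "(norm (\<pi> a h))\<^sup>2 + (norm (\<pi> c h))\<^sup>2 = s\<^sup>2 * (\<pi> e h \<bullet> h)"
    unfolding nrm[OF a] nrm[OF c] by (simp flip: inner_add_left)
  moreover have "\<pi> e h \<bullet> h \<le> (norm h)\<^sup>2"
  proof -
    have "(\<lambda>y. cnj (e y) * e y) = e"
      by (auto simp: e_def)
    then have "norm (\<pi> e h) * norm (\<pi> e h) \<le> norm (\<pi> e h) * norm h" and eq: "(norm (\<pi> e h))\<^sup>2 = \<pi> e h \<bullet> h"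
      using nrm[OF e] norm_cauchy_schwarz[of "\<pi> e h" h] by (auto simp: power2_eq_square)
    then have "norm (\<pi> e h) \<le> norm h"
      by (cases "\<pi> e h = 0") auto
    then show ?thesis
      by (simp flip: eq)
  qed
  ultimately have "(norm (\<pi> a h))\<^sup>2 \<le> s\<^sup>2 * (norm h)\<^sup>2"
    using mult_left_mono[of "\<pi> e h \<bullet> h" "(norm h)\<^sup>2" "s\<^sup>2"] zero_le_power2[of "norm (\<pi> c h)"]
      zero_le_power2[of s] by linarith
  then show ?thesis
    by (metis power_mult_distrib power2_le_imp_le mult_nonneg_nonneg s0 norm_ge_zero)
qed

text \<open>Extension by continuity from a uniformly dense *-subalgebra. By \<open>s_bound\<close>
  the map \<sigma> sends uniformly Cauchy sequences to sequences that are Cauchy at each vector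
  \<open>h\<close>. The limits are taken vector by vector, so the completeness that enters is that
  of the Hilbert space.\<close>

lemma representation_extend:
  fixes \<sigma> :: "('a \<Rightarrow> complex) \<Rightarrow> 'h::chilbert_space \<Rightarrow> 'h"
  assumes Y: "compact_space Y" and A: "A \<subseteq> cont_fun Y"
    and add: "\<And>f g. f \<in> A \<Longrightarrow> g \<in> A \<Longrightarrow> (\<lambda>y. f y + g y) \<in> A"
    and scale: "\<And>c f. f \<in> A \<Longrightarrow> (\<lambda>y. c * f y) \<in> A"
    and mult: "\<And>f g. f \<in> A \<Longrightarrow> g \<in> A \<Longrightarrow> (\<lambda>y. f y * g y) \<in> A"
    and cnj: "\<And>f. f \<in> A \<Longrightarrow> (\<lambda>y. cnj (f y)) \<in> A"
    and dense: "\<And>f e. f \<in> cont_fun Y \<Longrightarrow> 0 < e \<Longrightarrow> \<exists>g\<in>A. \<forall>y. cmod (f y - g y) \<le> e"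
    and ops: "\<And>f. f \<in> A \<Longrightarrow> \<sigma> f \<in> bounded_ops"
    and s_add: "\<And>f g h. f \<in> A \<Longrightarrow> g \<in> A \<Longrightarrow> \<sigma> (\<lambda>y. f y + g y) h = \<sigma> f h + \<sigma> g h"
    and s_scale: "\<And>c f h. f \<in> A \<Longrightarrow> \<sigma> (\<lambda>y. c * f y) h = c *\<^sub>C \<sigma> f h"
    and s_mult: "\<And>f g h. f \<in> A \<Longrightarrow> g \<in> A \<Longrightarrow> \<sigma> (\<lambda>y. f y * g y) h = \<sigma> f (\<sigma> g h)"
    and s_cnj: "\<And>f h k. f \<in> A \<Longrightarrow> \<sigma> (\<lambda>y. cnj (f y)) h \<bullet> k = h \<bullet> \<sigma> f k"
    and s_bound: "\<And>f s h. f \<in> A \<Longrightarrow> (\<And>y. cmod (f y) \<le> s) \<Longrightarrow> norm (\<sigma> f h) \<le> s * norm h"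
  shows "\<exists>\<rho>. representation Y \<rho> \<and> (\<forall>f\<in>A. \<rho> f = \<sigma> f)"
proof -
  define conv where "conv g f \<longleftrightarrow> (\<forall>k. g k \<in> A) \<and> uniform_limit UNIV g f sequentially"
    for g :: "nat \<Rightarrow> 'a \<Rightarrow> complex" and f
  have ex: "\<exists>g. conv g f" if f: "f \<in> cont_fun Y" for f
  proof -
    have "\<exists>g\<in>A. \<forall>y. cmod (f y - g y) \<le> 1 / real (Suc k)" for k
      by (rule dense[OF f]) simp
    then obtain g where g: "\<And>k. g k \<in> A" "\<And>k y. cmod (f y - g k y) \<le> 1 / real (Suc k)"
      by metis
    have "uniform_limit UNIV g f sequentially"
    proof (rule uniform_limitI)
      fix e :: real assume "0 < e"
      then have "\<forall>\<^sub>F k in sequentially. 1 / real (Suc k) < e"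
        using LIMSEQ_inverse_real_of_nat by (auto dest: order_tendstoD simp: inverse_eq_divide)
      then show "\<forall>\<^sub>F k in sequentially. \<forall>y\<in>UNIV. dist (g k y) (f y) < e"
        by eventually_elim (metis g(2) dist_norm norm_minus_commute le_less_trans)
    qed
    with g(1) show ?thesis
      by (auto simp: conv_def)
  qed
  define G where "G f = (SOME g. conv g f)" for f
  have G: "conv (G f) f" if "f \<in> cont_fun Y" for f
    unfolding G_def using ex[OF that] by (rule someI_ex)
  define \<rho> where "\<rho> f h = lim (\<lambda>k. \<sigma> (G f k) h)" for f h
  have diffA: "(\<lambda>y. f y - g y) \<in> A" "\<sigma> (\<lambda>y. f y - g y) h = \<sigma> f h - \<sigma> g h"
    if "f \<in> A" "g \<in> A" for f g h
    using add[OF that(1) scale[OF that(2), of "- 1"]]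
      s_add[OF that(1) scale[OF that(2), of "- 1"], of h] s_scale[OF that(2), of "- 1" h]
    by (simp_all add: scaleC_minus_one)
  have s_dist: "dist (\<sigma> f h) (\<sigma> g h) \<le> s * norm h"
    if "f \<in> A" "g \<in> A" "\<And>y. dist (f y) (g y) \<le> s" for f g h s
    using s_bound[OF diffA(1)[OF that(1,2)], of s h] that(3)
    by (simp add: diffA(2)[OF that(1,2)] dist_norm)
  have cancel: "a * (e / n / b) * n = a * e / b" if "n > 0" for a b e n :: real
    using that by simp
  have Cau: "convergent (\<lambda>k. \<sigma> (g k) h)" if g: "conv g f" for g f h
  proof (rule Cauchy_convergent, rule metric_CauchyI)
    fix e :: real assume "0 < e"
    \<comment> \<open>The summand 1 keeps the denominator positive at \<open>h = 0\<close>; the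
      third leaves \<open>2 * e / 3\<close> after the triangle inequality.\<close>
    then have e': "e / (norm h + 1) / 3 > 0"
      by (simp add: add_nonneg_pos)
    from uniform_limitD[OF conjunct2[OF g[unfolded conv_def]] e']
    obtain N where N: "\<And>k y. k \<ge> N \<Longrightarrow> dist (g k y) (f y) < e / (norm h + 1) / 3"
      by (auto simp: eventually_sequentially)
    have "dist (\<sigma> (g i) h) (\<sigma> (g j) h) < e" if "i \<ge> N" "j \<ge> N" for i j
    proof -
      have "dist (g i y) (g j y) \<le> 2 * (e / (norm h + 1) / 3)" for y
        using N[OF that(1), of y] N[OF that(2), of y] dist_triangle2[of "g i y" "g j y" "f y"] by simp
      then have "dist (\<sigma> (g i) h) (\<sigma> (g j) h) \<le> 2 * (e / (norm h + 1) / 3) * norm h"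
        using g by (intro s_dist) (auto simp: conv_def)
      also have "\<dots> \<le> 2 * (e / (norm h + 1) / 3) * (norm h + 1)"
        using e' by (intro mult_left_mono) auto
      also have "\<dots> = 2 * e / 3"
        by (rule cancel) (simp add: add_nonneg_pos)
      also have "\<dots> < e" using \<open>0 < e\<close> by simp
      finally show ?thesis .
    qed
    then show "\<exists>M. \<forall>i\<ge>M. \<forall>j\<ge>M. dist (\<sigma> (g i) h) (\<sigma> (g j) h) < e"
      by blast
  qed
  \<comment> \<open>Independence of the approximating sequence. Thanks to it the sum, product,
    multiple or conjugate of the chosen sequences can be used to compute \<rho> at the corresponding
    function.\<close>
  have lim: "(\<lambda>k. \<sigma> (g k) h) \<longlonglongrightarrow> \<rho> f h" if f: "f \<in> cont_fun Y" and g: "conv g f" for f g h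
  proof -
    have 1: "(\<lambda>k. \<sigma> (G f k) h) \<longlonglongrightarrow> \<rho> f h"
      unfolding \<rho>_def using Cau[OF G[OF f]] by (simp add: convergent_LIMSEQ_iff)
    have "(\<lambda>k. \<sigma> (g k) h - \<sigma> (G f k) h) \<longlonglongrightarrow> 0"
    proof (rule LIMSEQ_I)
      fix e :: real assume "0 < e"
      then have e': "e / (norm h + 1) / 2 > 0"
        by (simp add: add_nonneg_pos)
      have u: "uniform_limit UNIV (\<lambda>k y. g k y - G f k y) (\<lambda>y. f y - f y) sequentially"
        using g G[OF f] by (intro uniform_limit_minus) (auto simp: conv_def)
      from uniform_limitD[OF u e']
      obtain N where N: "\<And>k y. k \<ge> N \<Longrightarrow> dist (g k y) (G f k y) < e / (norm h + 1) / 2"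
        by (auto simp: eventually_sequentially dist_norm)
      have "norm (\<sigma> (g k) h - \<sigma> (G f k) h - 0) < e" if "k \<ge> N" for k
      proof -
        have "dist (\<sigma> (g k) h) (\<sigma> (G f k) h) \<le> e / (norm h + 1) / 2 * norm h"
          using g G[OF f] N[OF that] by (intro s_dist) (auto simp: conv_def less_imp_le)
        also have "\<dots> \<le> e / (norm h + 1) / 2 * (norm h + 1)"
          using e' by (intro mult_left_mono) auto
        also have "\<dots> = e / 2"
          using cancel[of "norm h + 1" 1 e 2] by (simp add: add_nonneg_pos)
        also have "\<dots> < e" using \<open>0 < e\<close> by simp
        finally show ?thesis by (simp add: dist_norm)
      qed
      then show "\<exists>N. \<forall>k\<ge>N. norm (\<sigma> (g k) h - \<sigma> (G f k) h - 0) < e"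
        by blast
    qed
    from tendsto_add[OF this 1] show ?thesis by simp
  qed
  \<comment> \<open>Once \<open>g k\<close> is within 1 of \<open>f\<close>, its supremum is at most
    \<open>M + 1\<close>. The operator bound is uniform in \<open>h\<close>, as needed for
    boundedness of the limit and for products; the bound on \<open>f\<close> itself serves the
    uniform convergence of products.\<close>
  have bnd: "\<exists>M>0. (\<forall>y. cmod (f y) \<le> M) \<and> (\<forall>\<^sub>F k in sequentially. \<forall>h. norm (\<sigma> (g k) h) \<le> (M + 1) * norm h)"
    if f: "f \<in> cont_fun Y" and g: "conv g f" for f g
  proof -
    obtain M where M: "M > 0" "\<And>y. cmod (f y) \<le> M"
      using cont_fun_bounded[OF Y f] by blast
    from g have "\<forall>\<^sub>F k in sequentially. \<forall>y\<in>UNIV. dist (g k y) (f y) < 1"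
      unfolding conv_def using uniform_limitD zero_less_one by blast
    then have "\<forall>\<^sub>F k in sequentially. \<forall>h. norm (\<sigma> (g k) h) \<le> (M + 1) * norm h"
    proof eventually_elim
      case (elim k)
      have "cmod (g k y) \<le> M + 1" for y
        using elim[rule_format, of y] M(2)[of y] norm_triangle_sub[of "g k y" "f y"] by (simp add: dist_norm)
      then show ?case
        using g by (auto simp: conv_def intro: s_bound)
    qed
    with M show ?thesis by blast
  qed
  have rep: "\<rho> f \<in> bounded_ops" if f: "f \<in> cont_fun Y" for f
  proof -
    obtain M where M: "\<forall>\<^sub>F k in sequentially. \<forall>h. norm (\<sigma> (G f k) h) \<le> (M + 1) * norm h"
      using bnd[OF f G[OF f]] by blast
    note L = lim[OF f G[OF f]]
    have GA: "G f k \<in> A" for k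
      using G[OF f] by (auto simp: conv_def)
    show ?thesis
    proof (rule bounded_opsI)
      show "\<rho> f (x + y) = \<rho> f x + \<rho> f y" for x y
        using LIMSEQ_unique[OF L[of "x + y"]] tendsto_add[OF L[of x] L[of y]]
        by (simp add: bounded_ops_add[OF ops[OF GA]])
      show "\<rho> f (c *\<^sub>C x) = c *\<^sub>C \<rho> f x" for c x
        using LIMSEQ_unique[OF L[of "c *\<^sub>C x"]] bounded_linear.tendsto[OF bounded_linear_scaleC L[of x]]
        by (simp add: bounded_ops_scaleC[OF ops[OF GA]])
      show "norm (\<rho> f x) \<le> norm x * (M + 1)" for x
        by (rule Lim_norm_ubound[OF _ L]) (use M in \<open>auto elim!: eventually_mono simp: mult.commute\<close>)
    qed
  qed
  have "representation Y \<rho>"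
    unfolding representation_def
  proof (intro conjI ballI allI ext)
    fix f h assume f: "f \<in> cont_fun Y"
    note Gf = G[OF f, unfolded conv_def] and L = lim[OF f G[OF f]]
    show "\<rho> f \<in> bounded_ops" by (rule rep[OF f])
    show "\<rho> (\<lambda>y. c * f y) h = c *\<^sub>C \<rho> f h" for c
    proof -
      have "conv (\<lambda>k y. c * G f k y) (\<lambda>y. c * f y)"
        using Gf by (auto simp: conv_def scale intro!: bounded_linear_uniform_limit_intros)
      from lim[OF cont_fun_scale[OF f] this, of h] bounded_linear.tendsto[OF bounded_linear_scaleC L[of h], of c]
      show ?thesis
        using Gf by (simp add: s_scale LIMSEQ_unique)
    qed
    have "\<rho> (\<lambda>y. cnj (f y)) = adj (\<rho> f)"
    proof (rule adj_eqI[OF rep[OF f], symmetric])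
      fix x z
      have "conv (\<lambda>k y. cnj (G f k y)) (\<lambda>y. cnj (f y))"
        using Gf by (auto simp: conv_def cnj intro!: bounded_linear.uniform_limit[OF bounded_linear_cnj])
      from tendsto_inner[OF lim[OF cont_fun_cnj[OF f] this, of x] tendsto_const[of z]]
        tendsto_inner[OF tendsto_const[of x] L[of z]]
      show "\<rho> (\<lambda>y. cnj (f y)) x \<bullet> z = x \<bullet> \<rho> f z"
        using Gf by (simp add: s_cnj LIMSEQ_unique)
    qed
    then show "\<rho> (\<lambda>y. cnj (f y)) h = adj (\<rho> f) h"
      by simp
    fix g assume g: "g \<in> cont_fun Y"
    note Gg = G[OF g, unfolded conv_def] and L' = lim[OF g G[OF g]]
    have "conv (\<lambda>k y. G f k y + G g k y) (\<lambda>y. f y + g y)"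
      using Gf Gg by (auto simp: conv_def add intro!: uniform_limit_add)
    from lim[OF cont_fun_add[OF f g] this, of h] tendsto_add[OF L[of h] L'[of h]]
    show "\<rho> (\<lambda>y. f y + g y) h = \<rho> f h + \<rho> g h"
      using Gf Gg by (simp add: s_add LIMSEQ_unique)
    obtain M where M: "\<And>y. cmod (f y) \<le> M" "M > 0"
      "\<forall>\<^sub>F k in sequentially. \<forall>h. norm (\<sigma> (G f k) h) \<le> (M + 1) * norm h"
      using bnd[OF f G[OF f]] by blast
    obtain M' where M': "\<And>y. cmod (g y) \<le> M'"
      using bnd[OF g G[OF g]] by blast
    have "conv (\<lambda>k y. G f k y * G g k y) (\<lambda>y. f y * g y)"
      using Gf Gg M(1) M' by (auto simp: conv_def mult intro!: uniform_lim_mult boundedI)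
    note L2 = lim[OF cont_fun_mult[OF f g] this, of h]
    \<comment> \<open>Both factors of the product vary with \<open>k\<close>. The inner value is
      replaced by its limit \<open>\<rho> g h\<close>, at a cost controlled by the uniform bound on
      the outer operators.\<close>
    have "(\<lambda>k. (M + 1) * norm (\<sigma> (G g k) h - \<rho> g h)) \<longlonglongrightarrow> (M + 1) * norm (\<rho> g h - \<rho> g h)"
      by (intro tendsto_intros L')
    then have "(\<lambda>k. (M + 1) * norm (\<sigma> (G g k) h - \<rho> g h)) \<longlonglongrightarrow> 0"
      by simp
    with eventually_mono[OF M(3) spec]
    have "(\<lambda>k. \<sigma> (G f k) (\<sigma> (G g k) h - \<rho> g h)) \<longlonglongrightarrow> 0"
      by (rule Lim_null_comparison)
    from tendsto_add[OF this L[of "\<rho> g h"]]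
    have "(\<lambda>k. \<sigma> (G f k) (\<sigma> (G g k) h)) \<longlonglongrightarrow> \<rho> f (\<rho> g h)"
      using Gf by (simp add: bounded_ops_diff[OF ops])
    with L2 show "\<rho> (\<lambda>y. f y * g y) h = (\<rho> f \<circ> \<rho> g) h"
      using Gf Gg by (simp add: s_mult LIMSEQ_unique)
  qed
  moreover have "\<rho> f = \<sigma> f" if f: "f \<in> A" for f
  proof
    fix h
    have "conv (\<lambda>_. f) f"
      using f by (auto simp: conv_def uniform_limit_const)
    with f A have "(\<lambda>_ :: nat. \<sigma> f h) \<longlonglongrightarrow> \<rho> f h"
      using lim[of f "\<lambda>_. f" h] by auto
    then show "\<rho> f h = \<sigma> f h"
      by (simp add: LIMSEQ_const_iff)
  qed
  ultimately show ?thesis by blast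
qed

section \<open>The reversible extension of a surjective partial map\<close>

lemma continuous_map_Some: "continuous_map X (adjoin_point X) Some"
  unfolding continuous_map openin_adjoin_point
proof (intro conjI allI impI)
  show "Some ` topspace X \<subseteq> topspace (adjoin_point X)"
    unfolding topspace_adjoin_point by blast
  fix U assume U: "openin X (Some -` U)"
  then have "{x \<in> topspace X. Some x \<in> U} = Some -` U"
    using openin_subset by blast
  with U show "openin X {x \<in> topspace X. Some x \<in> U}"
    by (simp only:)
qed

lemma openin_adjoin_point_Some: "openin (adjoin_point X) (Some ` V) \<longleftrightarrow> openin X V"
  by (simp add: openin_adjoin_point inj_vimage_image_eq)

lemma openin_adjoin_point_None: "openin (adjoin_point X) (insert None (Some ` V)) \<longleftrightarrow> openin X V"
proof -
  have "Some -` insert None (Some ` V) = V"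
    by blast
  then show ?thesis
    by (simp only: openin_adjoin_point)
qed

lemma closedin_adjoin_point_Some:
  assumes "closedin X K"
  shows "closedin (adjoin_point X) (Some ` K)"
proof -
  have "topspace (adjoin_point X) - Some ` K = insert None (Some ` (topspace X - K))"
    by (auto simp: topspace_adjoin_point)
  moreover have "K \<subseteq> topspace X" "openin X (topspace X - K)"
    using assms by (auto simp: closedin_def)
  ultimately show ?thesis
    by (simp add: closedin_def openin_adjoin_point_None, simp add: topspace_adjoin_point image_mono subset_insertI2)
qed

lemma compact_space_adjoin_point:
  assumes "compact_space X"
  shows "compact_space (adjoin_point X)"
proof -
  have "compactin (adjoin_point X) (Some ` topspace X)"
    using image_compactin[OF _ continuous_map_Some] assms by (auto simp: compact_space_def)
  moreover have "compactin (adjoin_point X) {None}"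
    by (simp add: topspace_adjoin_point)
  ultimately show ?thesis
    unfolding compact_space_def topspace_adjoin_point
    using compactin_Un by (metis insert_is_Un)
qed

lemma Hausdorff_space_adjoin_point:
  assumes "Hausdorff_space X"
  shows "Hausdorff_space (adjoin_point X)"
  unfolding Hausdorff_space_def
proof (intro allI impI, elim conjE)
  fix x y assume xy: "x \<in> topspace (adjoin_point X)" "y \<in> topspace (adjoin_point X)" "x \<noteq> y"
  have None: "openin (adjoin_point X) {None}"
    using openin_adjoin_point_None[of X "{}"] by simp
  have top: "openin (adjoin_point X) (Some ` topspace X)"
    by (simp add: openin_adjoin_point_Some)
  show "\<exists>V W. openin (adjoin_point X) V \<and> openin (adjoin_point X) W \<and> x \<in> V \<and> y \<in> W \<and> disjnt V W"
  proof (cases "x = None \<or> y = None")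
    case True
    then show ?thesis
      using xy None top unfolding topspace_adjoin_point disjnt_def by blast
  next
    case False
    then obtain u v where uv: "x = Some u" "y = Some v" "u \<in> topspace X" "v \<in> topspace X" "u \<noteq> v"
      using xy by (auto simp: topspace_adjoin_point)
    then obtain V W where "openin X V" "openin X W" "u \<in> V" "v \<in> W" "disjnt V W"
      using assms unfolding Hausdorff_space_def by metis
    then show ?thesis
      using uv by (intro exI[of _ "Some ` V"] exI[of _ "Some ` W"])
        (auto simp: openin_adjoin_point_Some disjnt_def)
  qed
qed

lemma surj_if_inj_endo:
  assumes X: "compact_space X" "Hausdorff_space X" and D: "openin X D" "closedin X D"
    and cont: "continuous_map (subtopology X D) X \<alpha>" and op: "openin X (\<alpha> ` D)"
    and inj: "inj_on (endo D \<alpha>) (cont_fun X)"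
  shows "\<alpha> ` D = topspace X"
proof (rule ccontr)
  assume "\<alpha> ` D \<noteq> topspace X"
  then obtain z where z: "z \<in> topspace X" "z \<notin> \<alpha> ` D"
    using openin_subset[OF op] by blast
  have "compactin (subtopology X D) D"
    using closedin_compact_space[OF X(1) D(2)] by (simp add: compactin_subtopology)
  then have cl: "closedin X (\<alpha> ` D)"
    by (intro compactin_imp_closedin[OF X(2)] image_compactin[OF _ cont])
  define c where "c = (\<lambda>y. if y \<in> topspace X - \<alpha> ` D then 1 else 0 :: complex)"
  have "c \<in> cont_fun X"
    using indicator_cont_fun[of X "topspace X - \<alpha> ` D"] op cl
    by (simp add: c_def cont_fun_on_def openin_diff closedin_diff)
  moreover have "(\<lambda>_. 0) \<in> cont_fun X"
    by (simp add: cont_fun_def)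
  moreover have "endo D \<alpha> c = endo D \<alpha> (\<lambda>_. 0)"
    by (auto simp: endo_def c_def)
  ultimately have "c = (\<lambda>_. 0)"
    using inj by (auto dest: inj_onD)
  then have "c z = 0"
    by simp
  then show False
    using z by (simp add: c_def)
qed

text \<open>From here on injectivity of the endomorphism enters only through \<open>surj\<close>,
  which \<open>surj_if_inj_endo\<close> provides.\<close>

locale surjective_partial_map =
  fixes X :: "'a topology" and D :: "'a set" and \<alpha> :: "'a \<Rightarrow> 'a"
  assumes compact: "compact_space X" and Hausdorff: "Hausdorff_space X"
    and D_open: "openin X D" and D_closed: "closedin X D"
    and cont: "continuous_map (subtopology X D) X \<alpha>"
    and surj: "\<alpha> ` D = topspace X"
begin

abbreviation "\<Delta> \<equiv> Delta X D \<alpha>"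
abbreviation "\<delta> \<equiv> endo D \<alpha>"
abbreviation "XE \<equiv> X_ext X D \<alpha>"

lemma Delta_0: "\<Delta> 0 = topspace X"
  by (simp add: Delta_def)

lemma D_subset: "D \<subseteq> topspace X"
  using D_open by (rule openin_subset)

text \<open>The first application of \<alpha> is split off, not the last. This gives a condition on
  \<open>\<alpha> x\<close>, the form that fits both \<open>a \<circ> \<alpha>\<close> and the
  relation between consecutive coordinates.\<close>

lemma Delta_Suc: "\<Delta> (Suc n) = {x \<in> D. \<alpha> x \<in> \<Delta> n}"
proof -
  have "(\<forall>k<Suc n. (\<alpha> ^^ k) x \<in> D) \<longleftrightarrow> x \<in> D \<and> (\<forall>k<n. (\<alpha> ^^ k) (\<alpha> x) \<in> D)" for x
    by (simp add: All_less_Suc2 funpow_swap1)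
  then show ?thesis
    using surj D_subset unfolding Delta_def by blast
qed

lemma Delta_1: "\<Delta> 1 = D"
  using surj by (auto simp: Delta_Suc[of 0, simplified] Delta_0)

lemma Delta_antimono: "m \<le> n \<Longrightarrow> \<Delta> n \<subseteq> \<Delta> m"
  by (auto simp: Delta_def)

lemma Delta_subset: "\<Delta> n \<subseteq> topspace X"
  by (auto simp: Delta_def)

lemma Delta_clopen: "openin X (\<Delta> n)" "closedin X (\<Delta> n)"
proof (induction n)
  case (Suc n)
  have eq: "\<Delta> (Suc n) = {x \<in> topspace (subtopology X D). \<alpha> x \<in> \<Delta> n}"
    using D_subset by (auto simp: Delta_Suc)
  show "openin X (\<Delta> (Suc n))"
    unfolding eq using openin_continuous_map_preimage[OF cont Suc(1)] D_open openin_trans_full by blast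
  show "closedin X (\<Delta> (Suc n))"
    unfolding eq using closedin_continuous_map_preimage[OF cont Suc(2)] D_closed closedin_trans_full by blast
qed (simp_all add: Delta_0)

lemma endo_cont_fun_on:
  assumes "a \<in> cont_fun_on (\<Delta> n) X"
  shows "\<delta> a \<in> cont_fun_on (\<Delta> (Suc n)) X"
proof -
  have "\<delta> a y = 0" if "y \<notin> \<Delta> (Suc n)" for y
    using that assms surj by (auto simp: endo_def Delta_Suc cont_fun_on_def)
  then show ?thesis
    using assms endo_cont_fun[OF D_open D_closed cont] by (auto simp: cont_fun_on_def)
qed

text \<open>Since \<open>\<alpha>\<close> is surjective, no sequence in the extension terminates.\<close>

lemma topspace_XE: "topspace XE = X_inf X D \<alpha>"
proof -
  have "Some ` \<Delta> N \<subseteq> Some ` \<alpha> ` D" for N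
    using Delta_subset surj by blast
  then have "X_fin X D \<alpha> N = {}" for N
    unfolding X_fin_def by blast
  moreover have "Some ` \<Delta> n \<subseteq> topspace (adjoin_point X)" for n
    using Delta_subset unfolding topspace_adjoin_point by blast
  then have "X_inf X D \<alpha> \<subseteq> (\<Pi>\<^sub>E n\<in>UNIV. topspace (adjoin_point X))"
    unfolding X_inf_def PiE_UNIV_domain by blast
  ultimately show ?thesis
    by (simp add: X_ext_def Int_absorb1)
qed

lemma XE_eq: "XE = subtopology (product_topology (\<lambda>n. adjoin_point X) UNIV) (X_inf X D \<alpha>)"
  using topspace_XE unfolding X_ext_def
  by (metis subtopology_restrict topspace_subtopology)

lemma mem_XE_iff:
  "x \<in> topspace XE \<longleftrightarrow> (\<forall>n. x n \<in> Some ` \<Delta> n) \<and> (\<forall>n. map_option \<alpha> (x (Suc n)) = x n)"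
proof -
  have "(\<forall>n\<ge>1. P n) \<longleftrightarrow> (\<forall>n. P (Suc n))" for P
    by (metis One_nat_def Suc_le_D le_add1 plus_1_eq_Suc)
  then show ?thesis
    unfolding topspace_XE X_inf_def by simp
qed

lemma
  assumes "x \<in> topspace XE"
  shows XE_Some: "x n = Some (the (x n))" and XE_Delta: "the (x n) \<in> \<Delta> n"
    and XE_shift: "\<alpha> (the (x (Suc n))) = the (x n)"
proof -
  have *: "x n = Some (the (x n)) \<and> the (x n) \<in> \<Delta> n" for n
    using assms unfolding mem_XE_iff by (metis image_iff option.sel)
  then show "x n = Some (the (x n))" "the (x n) \<in> \<Delta> n" by blast+
  show "\<alpha> (the (x (Suc n))) = the (x n)"
    using assms * unfolding mem_XE_iff by (metis option.map_sel option.distinct(1))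
qed

text \<open>Going down, each coordinate is \<alpha> of the next one. Hence one coordinate controls
  any finite set of coordinates below it, and with that a basic neighbourhood.\<close>

lemma XE_agree:
  assumes "x \<in> topspace XE" "y \<in> topspace XE" "the (x n) = the (y n)" "m \<le> n"
  shows "x m = y m"
  using assms(4,3)
proof (induction n rule: dec_induct)
  case base
  then show ?case
    using XE_Some assms by metis
next
  case (step n)
  then show ?case
    using XE_shift assms by metis
qed

lemma coord_continuous: "continuous_map XE X (\<lambda>x. the (x n))"
  unfolding continuous_map
proof (intro conjI allI impI)
  show "(\<lambda>x. the (x n)) ` topspace XE \<subseteq> topspace X"
    using XE_Delta Delta_subset by blast
  fix V assume V: "openin X V"
  have c: "continuous_map XE (adjoin_point X) (\<lambda>x. x n)"
    unfolding XE_eq by (intro continuous_intros) simp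
  have "{x \<in> topspace XE. the (x n) \<in> V} = {x \<in> topspace XE. x n \<in> Some ` V}"
    by (auto intro: XE_Some rev_image_eqI)
  then show "openin XE {x \<in> topspace XE. the (x n) \<in> V}"
    using openin_continuous_map_preimage[OF c] V by (simp add: openin_adjoin_point_Some)
qed

text \<open>Below index \<open>n\<close> the coordinates are forced to be iterates of \<alpha>;
  above it they are chosen with a right inverse \<open>s\<close> of \<alpha>, which exists because
  \<alpha> is onto and takes values in \<open>D\<close>, so that each choice climbs one
  \<open>\<Delta>\<close>.\<close>

lemma coord_surj:
  assumes y: "y \<in> \<Delta> n"
  obtains x where "x \<in> topspace XE" "x n = Some y"
proof -
  obtain s where s: "\<And>z. z \<in> topspace X \<Longrightarrow> s z \<in> D \<and> \<alpha> (s z) = z"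
  proof -
    have "\<forall>z\<in>topspace X. \<exists>x. x \<in> D \<and> \<alpha> x = z"
      unfolding surj[symmetric] by blast
    from bchoice[OF this] show thesis
      using that by blast
  qed
  define z where "z m = (if m \<le> n then (\<alpha> ^^ (n - m)) y else (s ^^ (m - n)) y)" for m
  have down: "(\<alpha> ^^ k) y \<in> \<Delta> (n - k)" if "k \<le> n" for k
    using that
  proof (induction k)
    case (Suc k)
    then have "(\<alpha> ^^ k) y \<in> \<Delta> (Suc (n - Suc k))"
      by (simp add: Suc_diff_Suc)
    then show ?case
      by (simp add: Delta_Suc)
  qed (use y in simp)
  have up: "(s ^^ k) y \<in> \<Delta> (n + k)" for k
  proof (induction k)
    case (Suc k)
    then show ?case
      using s[OF subsetD[OF Delta_subset Suc]] by (simp add: Delta_Suc)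
  qed (use y in simp)
  have "z m \<in> \<Delta> m" for m
    using down[of "n - m"] up[of "m - n"] by (auto simp: z_def)
  moreover have "\<alpha> (z (Suc m)) = z m" for m
  proof (cases "Suc m \<le> n")
    case True
    then have "n - m = Suc (n - Suc m)" by simp
    with True show ?thesis by (simp add: z_def)
  next
    case False
    then have "Suc m - n = Suc (m - n)" by simp
    with False show ?thesis
      using s[OF subsetD[OF Delta_subset up]] by (auto simp: z_def)
  qed
  ultimately have "(\<lambda>m. Some (z m)) \<in> topspace XE"
    by (simp add: mem_XE_iff)
  then show thesis
    by (rule that) (simp add: z_def)
qed

lemma continuous_map_alpha_option:
  "continuous_map (adjoin_point X) (adjoin_point X) (\<lambda>u. if u \<in> Some ` D then map_option \<alpha> u else None)"
  unfolding continuous_map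
proof (intro conjI allI impI)
  show "(\<lambda>u. if u \<in> Some ` D then map_option \<alpha> u else None) ` topspace (adjoin_point X)
      \<subseteq> topspace (adjoin_point X)"
    using surj by (auto simp: topspace_adjoin_point)
  fix V assume V: "openin (adjoin_point X) V"
  let ?W = "{u \<in> topspace (adjoin_point X). (if u \<in> Some ` D then map_option \<alpha> u else None) \<in> V}"
  have "openin (subtopology X D) {x \<in> topspace (subtopology X D). \<alpha> x \<in> Some -` V}"
    using V cont by (intro openin_continuous_map_preimage) (auto simp: openin_adjoin_point)
  then have "openin X {x \<in> topspace (subtopology X D). \<alpha> x \<in> Some -` V}"
    using D_open openin_trans_full by blast
  moreover have "Some -` ?W = {x \<in> topspace (subtopology X D). \<alpha> x \<in> Some -` V} \<union>
      (if None \<in> V then topspace X - D else {})"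
    using D_subset by (auto simp: topspace_adjoin_point)
  ultimately show "openin (adjoin_point X) ?W"
    using D_closed by (auto simp: openin_adjoin_point closedin_def)
qed

text \<open>The sequences in question are cut out of the product by closed conditions, one
  membership and one equation for each index, and the product is compact by Tychonoff.\<close>

lemma compact_XE: "compact_space XE"
proof -
  let ?P = "product_topology (\<lambda>n :: nat. adjoin_point X) UNIV"
  let ?a = "\<lambda>u. if u \<in> Some ` D then map_option \<alpha> u else None"
  have p: "continuous_map ?P (adjoin_point X) (\<lambda>x. x n)" for n
    by (intro continuous_intros) simp
  have q: "continuous_map ?P (adjoin_point X) (\<lambda>x. ?a (x n))" for n
    using continuous_map_compose[OF p continuous_map_alpha_option] by (simp only: comp_def)
  have top: "x n \<in> topspace (adjoin_point X)" and a: "?a (x (Suc n)) = map_option \<alpha> (x (Suc n))"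
    if "\<forall>n. x n \<in> Some ` \<Delta> n" for x n
  proof -
    have "Some ` \<Delta> n \<subseteq> topspace (adjoin_point X)" "Some ` \<Delta> (Suc n) \<subseteq> Some ` D"
      using Delta_subset by (auto simp: Delta_Suc topspace_adjoin_point)
    from subsetD[OF this(1) that[rule_format]] subsetD[OF this(2) that[rule_format]]
    show "x n \<in> topspace (adjoin_point X)" "?a (x (Suc n)) = map_option \<alpha> (x (Suc n))"
      by simp_all
  qed
  have "X_inf X D \<alpha> = (\<Inter>n. {x \<in> topspace ?P. x n \<in> Some ` \<Delta> n}) \<inter>
      (\<Inter>n. {x \<in> topspace ?P. ?a (x (Suc n)) = x n})"
  proof (rule set_eqI)
    fix x
    have "x \<in> X_inf X D \<alpha> \<longleftrightarrow> (\<forall>n. x n \<in> Some ` \<Delta> n) \<and> (\<forall>n. ?a (x (Suc n)) = x n)"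
      using a[of x] unfolding topspace_XE[symmetric] mem_XE_iff by metis
    also have "\<dots> \<longleftrightarrow> (\<forall>n. x \<in> topspace ?P \<and> x n \<in> Some ` \<Delta> n) \<and> (\<forall>n. x \<in> topspace ?P \<and> ?a (x (Suc n)) = x n)"
      using top[of x] unfolding topspace_product_topology PiE_UNIV_domain Pi_iff by blast
    finally show "x \<in> X_inf X D \<alpha> \<longleftrightarrow> x \<in> (\<Inter>n. {x \<in> topspace ?P. x n \<in> Some ` \<Delta> n}) \<inter>
      (\<Inter>n. {x \<in> topspace ?P. ?a (x (Suc n)) = x n})"
      unfolding Int_iff INT_iff mem_Collect_eq by blast
  qed
  moreover have "closedin ?P \<dots>"
  proof (intro closedin_Int closedin_INT)
    show "closedin ?P {x \<in> topspace ?P. x n \<in> Some ` \<Delta> n}" for n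
      by (rule closedin_continuous_map_preimage[OF p closedin_adjoin_point_Some[OF Delta_clopen(2)]])
    show "closedin ?P {x \<in> topspace ?P. ?a (x (Suc n)) = x n}" for n
      by (rule closedin_continuous_maps_eq[OF Hausdorff_space_adjoin_point[OF Hausdorff] q p])
  qed simp_all
  ultimately have "closedin ?P (X_inf X D \<alpha>)"
    by simp
  moreover have "compact_space ?P"
    unfolding compact_space_product_topology using compact_space_adjoin_point[OF compact] by blast
  ultimately show ?thesis
    unfolding XE_eq by (intro compact_space_subtopology closedin_compact_space)
qed

lemma closedin_coord_image:
  assumes "closedin XE G"
  shows "closedin X ((\<lambda>x. the (x n)) ` G)"
  using assms by (intro compactin_imp_closedin[OF Hausdorff] image_compactin[OF _ coord_continuous]
      closedin_compact_space[OF compact_XE])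

text \<open>If the images always met, the nested compact sets \<open>F \<inter> \<Phi>\<^sub>n\<^sup>-\<^sup>1(\<Phi>\<^sub>n(G))\<close> would have a common point,
  and it would lie in the closure of \<open>G\<close>.\<close>

lemma coord_separates:
  assumes F: "closedin XE F" and G: "closedin XE G" and dis: "F \<inter> G = {}"
  shows "\<exists>n. (\<lambda>x. the (x n)) ` F \<inter> (\<lambda>x. the (x n)) ` G = {}"
proof (rule ccontr)
  assume contra: "\<not> ?thesis"
  define C where "C n = F \<inter> {x \<in> topspace XE. the (x n) \<in> (\<lambda>x. the (x n)) ` G}" for n
  have GT: "G \<subseteq> topspace XE" and FT: "F \<subseteq> topspace XE"
    using F G closedin_subset by auto
  have "closedin XE (C n)" for n
    unfolding C_def using F closedin_coord_image[OF G]
    by (intro closedin_Int closedin_continuous_map_preimage[OF coord_continuous])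
  moreover have "C n \<noteq> {}" for n
    using contra FT unfolding C_def by fastforce
  moreover have "decseq C"
  proof (rule decseq_SucI, rule subsetI)
    fix n x assume x: "x \<in> C (Suc n)"
    then obtain y where y: "y \<in> G" "the (x (Suc n)) = the (y (Suc n))" "x \<in> F" "x \<in> topspace XE"
      by (auto simp: C_def)
    then have "the (x n) = the (y n)"
      using XE_shift[of x n] XE_shift[OF subsetD[OF GT y(1)], of n] by simp
    with y show "x \<in> C n"
      unfolding C_def by blast
  qed
  ultimately have "(\<Inter>n. C n) \<noteq> {}"
    by (rule compact_space_imp_nest[OF compact_XE])
  then obtain x where x: "\<And>n. x \<in> C n"
    by blast
  then have xT: "x \<in> topspace XE" and xG: "x \<notin> G"
    using dis by (auto simp: C_def)
  have "openin XE (topspace XE - G)"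
    using G by blast
  then obtain W where W: "openin (product_topology (\<lambda>n. adjoin_point X) UNIV) W"
    and WG: "topspace XE - G = W \<inter> X_inf X D \<alpha>"
    unfolding XE_eq openin_subtopology by blast
  have "x \<in> W" using xT xG WG by blast
  then obtain V where V: "finite {i. V i \<noteq> topspace (adjoin_point X)}" "x \<in> Pi\<^sub>E UNIV V" "Pi\<^sub>E UNIV V \<subseteq> W"
    using W unfolding openin_product_topology_alt by auto
  \<comment> \<open>A basic neighbourhood of \<open>x\<close> constrains finitely many coordinates,
    all of index at most \<open>n\<close>. A point \<open>y\<close> of \<open>G\<close> with the
    same coordinate \<open>n\<close> agrees with \<open>x\<close> at all of these, so it lies in
    \<open>W\<close>, which misses \<open>G\<close>.\<close>
  obtain n where n: "\<And>i. V i \<noteq> topspace (adjoin_point X) \<Longrightarrow> i \<le> n"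
    using V(1) unfolding finite_nat_set_iff_bounded_le by auto
  from x[of n] obtain y where y: "y \<in> G" "the (x n) = the (y n)"
    by (auto simp: C_def)
  have "y i \<in> V i" for i
  proof (cases "V i = topspace (adjoin_point X)")
    case True
    have "y \<in> (\<Pi>\<^sub>E n\<in>UNIV. topspace (adjoin_point X))"
      using y(1) GT unfolding XE_eq topspace_subtopology topspace_product_topology by blast
    then show ?thesis
      unfolding True by (rule PiE_mem) simp
  next
    case False
    then have "x i = y i"
      using XE_agree[OF xT subsetD[OF GT y(1)] y(2)] n by blast
    then show ?thesis
      using V(2) by (metis PiE_mem UNIV_I)
  qed
  then have "y \<in> W"
    using V(3) by auto
  then show False
    using WG y(1) GT topspace_XE by blast
qed

section \<open>The algebra of functions of a single coordinate\<close>

definition lev :: "nat \<Rightarrow> ('a \<Rightarrow> complex) \<Rightarrow> (nat \<Rightarrow> 'a option) \<Rightarrow> complex" where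
  "lev n a = (\<lambda>x. if x \<in> topspace XE then a (the (x n)) else 0)"

text \<open>Coordinate \<open>n\<close> of a point of the extension lies in
  \<open>\<Delta> n\<close>, so \<open>lev n a\<close> sees \<open>a\<close> only there. The support
  condition removes the remaining freedom in \<open>a\<close>.\<close>

definition levels :: "((nat \<Rightarrow> 'a option) \<Rightarrow> complex) set" where
  "levels = (\<Union>n. lev n ` cont_fun_on (\<Delta> n) X)"

lemma lev_add: "lev n (\<lambda>y. a y + b y) = (\<lambda>x. lev n a x + lev n b x)"
  and lev_mult: "lev n (\<lambda>y. a y * b y) = (\<lambda>x. lev n a x * lev n b x)"
  and lev_scale: "lev n (\<lambda>y. c * a y) = (\<lambda>x. c * lev n a x)"
  and lev_cnj: "lev n (\<lambda>y. cnj (a y)) = (\<lambda>x. cnj (lev n a x))"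
  by (auto simp: lev_def)

lemma lev_cont_fun:
  assumes "a \<in> cont_fun X"
  shows "lev n a \<in> cont_fun XE"
proof -
  have "continuous_map XE euclidean (a \<circ> (\<lambda>x. the (x n)))"
    using assms continuous_map_compose[OF coord_continuous] by (auto simp: cont_fun_def)
  then have "continuous_map XE euclidean (lev n a)"
    by (rule continuous_map_eq) (simp add: lev_def)
  then show ?thesis
    by (simp add: cont_fun_def lev_def)
qed

lemma levels_cont_fun: "levels \<subseteq> cont_fun XE"
  unfolding levels_def using lev_cont_fun cont_fun_onD by blast

lemma lev_lift: "lev (Suc n) (\<delta> a) = lev n a"
  using XE_Delta[of _ "Suc n"] XE_shift by (auto simp: lev_def endo_def Delta_Suc fun_eq_iff)

lemma lev_lift_funpow: "lev (k + n) ((\<delta> ^^ k) a) = lev n a"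
  by (induction k) (simp_all add: lev_lift)

lemma funpow_endo_cont_fun_on:
  "a \<in> cont_fun_on (\<Delta> n) X \<Longrightarrow> (\<delta> ^^ k) a \<in> cont_fun_on (\<Delta> (k + n)) X"
  by (induction k) (simp_all add: endo_cont_fun_on)

text \<open>By \<open>lev_lift\<close> the levels form an increasing chain; each function is raised
  by the level of the other. Closure of the union under the algebra operations thus reduces to a
  single level.\<close>

lemma levels_common:
  assumes "f \<in> levels" "g \<in> levels"
  obtains n a b where "f = lev n a" "g = lev n b" "a \<in> cont_fun_on (\<Delta> n) X" "b \<in> cont_fun_on (\<Delta> n) X"
proof -
  obtain i a j b where *: "f = lev i a" "g = lev j b" "a \<in> cont_fun_on (\<Delta> i) X" "b \<in> cont_fun_on (\<Delta> j) X"
    using assms by (auto simp: levels_def)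
  show thesis
  proof (rule that)
    show "f = lev (j + i) ((\<delta> ^^ j) a)" "g = lev (j + i) ((\<delta> ^^ i) b)"
      unfolding * by (simp_all only: lev_lift_funpow, subst add.commute, simp only: lev_lift_funpow)
    show "(\<delta> ^^ j) a \<in> cont_fun_on (\<Delta> (j + i)) X" "(\<delta> ^^ i) b \<in> cont_fun_on (\<Delta> (j + i)) X"
      using funpow_endo_cont_fun_on[OF *(3), of j] funpow_endo_cont_fun_on[OF *(4), of i]
      by (simp_all add: add.commute)
  qed
qed

lemma levelsI: "a \<in> cont_fun_on (\<Delta> n) X \<Longrightarrow> lev n a \<in> levels"
  by (auto simp: levels_def)

lemma levels_add:
  assumes "f \<in> levels" "g \<in> levels"
  shows "(\<lambda>x. f x + g x) \<in> levels"
  using assms by (rule levels_common) (simp only: lev_add[symmetric] levelsI cont_fun_on_add)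

lemma levels_mult:
  assumes "f \<in> levels" "g \<in> levels"
  shows "(\<lambda>x. f x * g x) \<in> levels"
  using assms by (rule levels_common) (simp only: lev_mult[symmetric] levelsI cont_fun_on_mult cont_fun_onD)

lemma levels_scale:
  assumes "f \<in> levels"
  shows "(\<lambda>x. c * f x) \<in> levels"
  using assms assms by (rule levels_common) (simp only: lev_scale[symmetric] levelsI cont_fun_on_scale)

lemma levels_cnj:
  assumes "f \<in> levels"
  shows "(\<lambda>x. cnj (f x)) \<in> levels"
  using assms assms by (rule levels_common) (simp only: lev_cnj[symmetric] levelsI cont_fun_on_cnj)

text \<open>Every point of \<open>\<Delta> n\<close> is coordinate \<open>n\<close> of some point of
  the extension, and \<open>a\<close> vanishes elsewhere. So a bound on the extension is a bound on
  the coefficient, to which contractivity of a representation of \<open>cont_fun X\<close> can be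
  applied.\<close>

lemma lev_bound:
  assumes "a \<in> cont_fun_on (\<Delta> n) X" "\<And>x. cmod (lev n a x) \<le> s"
  shows "cmod (a y) \<le> s"
proof (cases "y \<in> \<Delta> n")
  case True
  then obtain x where "x \<in> topspace XE" "x n = Some y"
    by (rule coord_surj)
  then show ?thesis
    using assms(2)[of x] by (simp add: lev_def)
next
  case False
  then have "a y = 0"
    using assms(1) by (auto simp: cont_fun_on_def cont_fun_def)
  then show ?thesis
    using assms(2)[of undefined] norm_ge_zero[of "lev n a undefined"] by (simp add: order_trans[OF norm_ge_zero])
qed

text \<open>The bound 0 for the difference, written as \<open>a y + - 1 * b y\<close> so that the
  closure lemmas for sums and multiples apply.\<close>

lemma lev_inj:
  assumes ab: "a \<in> cont_fun_on (\<Delta> n) X" "b \<in> cont_fun_on (\<Delta> n) X" and eq: "lev n a = lev n b"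
  shows "a = b"
proof
  fix y
  have "lev n (\<lambda>y. a y + - 1 * b y) = (\<lambda>x. lev n a x + - 1 * lev n b x)"
    by (simp only: lev_add lev_scale)
  then have "cmod (lev n (\<lambda>y. a y + - 1 * b y) x) \<le> 0" for x
    by (simp add: eq)
  then have "cmod (a y + - 1 * b y) \<le> 0"
    by (rule lev_bound[OF cont_fun_on_add[OF ab(1) cont_fun_on_scale[OF ab(2)]]])
  then show "a y = b y" by simp
qed

text \<open>One step of the approximation: a Urysohn function pulled back from a level that separates
  \<open>{f \<le> -M/3}\<close> from \<open>{f \<ge> M/3}\<close> reduces the error by the factor \<open>2/3\<close>.\<close>

lemma levels_step:
  fixes f :: "(nat \<Rightarrow> 'a option) \<Rightarrow> real"
  assumes f: "continuous_map XE euclideanreal f" and M: "0 < M"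
    and b: "\<And>x. x \<in> topspace XE \<Longrightarrow> \<bar>f x\<bar> \<le> M"
  shows "\<exists>g. (\<lambda>x. complex_of_real (g x)) \<in> levels \<and> (\<forall>x\<in>topspace XE. \<bar>f x - g x\<bar> \<le> 2/3 * M)"
proof -
  \<comment> \<open>The threshold \<open>M/3\<close> balances the cases: on \<open>F\<close> and
    \<open>G\<close> the value of \<open>f\<close> lies between \<open>M/3\<close> and
    \<open>M\<close> in modulus with the sign of \<open>g\<close>, and in between both
    \<open>f\<close> and \<open>g\<close> are at most \<open>M/3\<close> in modulus. Each error is
    at most \<open>2/3 * M\<close>.\<close>
  define F where "F = {x \<in> topspace XE. f x \<in> {..- M/3}}"
  define G where "G = {x \<in> topspace XE. f x \<in> {M/3..}}"
  have FG: "closedin XE F" "closedin XE G"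
    unfolding F_def G_def by (rule closedin_continuous_map_preimage[OF f], simp)+
  have "\<not> (r \<le> - M/3 \<and> M/3 \<le> r)" for r
    using M by linarith
  then have "F \<inter> G = {}"
    unfolding F_def G_def by auto
  from coord_separates[OF FG this] obtain n
    where n: "(\<lambda>x. the (x n)) ` F \<inter> (\<lambda>x. the (x n)) ` G = {}" by blast
  have "normal_space X"
    using compact Hausdorff compact_Hausdorff_or_regular_imp_normal_space by blast
  then obtain u where u: "continuous_map X (top_of_set {-M/3..M/3}) u"
    "u ` (\<lambda>x. the (x n)) ` F \<subseteq> {-M/3}" "u ` (\<lambda>x. the (x n)) ` G \<subseteq> {M/3}"
    by (rule Urysohn_lemma[OF _ closedin_coord_image[OF FG(1), of n] closedin_coord_image[OF FG(2), of n],
          of "-M/3" "M/3"]) (use n M in \<open>auto simp: disjnt_def\<close>)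
  have u1: "continuous_map X euclideanreal u" and u2: "\<And>y. y \<in> topspace X \<Longrightarrow> \<bar>u y\<bar> \<le> M/3"
    using u(1) by (fastforce simp: continuous_map_in_subtopology Pi_iff)+
  \<comment> \<open>Cutting off outside \<open>\<Delta> n\<close> gives the required support. It
    keeps continuity, since \<open>\<Delta> n\<close> is clopen, and changes nothing on the
    extension, where coordinate \<open>n\<close> never leaves \<open>\<Delta> n\<close>.\<close>
  define v where "v y = (if y \<in> \<Delta> n then complex_of_real (u y) else 0)" for y
  have "continuous_map X euclidean (\<lambda>y. complex_of_real (u y))"
    using u1 unfolding continuous_map_atin by (auto intro!: tendsto_intros)
  then have "continuous_map X euclidean v"
    unfolding v_def
    by (intro continuous_map_cases_clopen Delta_clopen) (auto intro: continuous_map_from_subtopology)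
  then have v: "v \<in> cont_fun_on (\<Delta> n) X"
    using Delta_subset by (auto simp: cont_fun_on_def cont_fun_def v_def)
  define g where "g x = (if x \<in> topspace XE then u (the (x n)) else 0)" for x
  have "lev n v = (\<lambda>x. complex_of_real (g x))"
    using XE_Delta by (auto simp: lev_def v_def g_def)
  moreover have "\<bar>f x - g x\<bar> \<le> 2/3 * M" if x: "x \<in> topspace XE" for x
  proof -
    have g: "\<bar>g x\<bar> \<le> M/3" "x \<in> F \<Longrightarrow> g x = -M/3" "x \<in> G \<Longrightarrow> g x = M/3"
      using u(2,3) u2[of "the (x n)"] x XE_Delta[OF x, of n] Delta_subset[of n]
      by (auto simp: g_def image_subset_iff)
    consider "f x \<le> -M/3" | "f x \<ge> M/3" | "\<bar>f x\<bar> \<le> M/3"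
      by linarith
    then show ?thesis
    proof cases
      case 1
      then have "g x = -M/3" using g(2) x by (simp add: F_def)
      then show ?thesis using 1 b[OF x] by linarith
    next
      case 2
      then have "g x = M/3" using g(3) x by (simp add: G_def)
      then show ?thesis using 2 b[OF x] by linarith
    next
      case 3
      then show ?thesis using g(1) by linarith
    qed
  qed
  ultimately show ?thesis
    using levelsI[OF v] by metis
qed

text \<open>The iteration known from the Tietze extension theorem: \<open>levels_step\<close> is
  applied to the error left so far, and its result is added as a correction.\<close>

lemma levels_approx_real:
  fixes f :: "(nat \<Rightarrow> 'a option) \<Rightarrow> real"
  assumes f: "continuous_map XE euclideanreal f" and M: "0 < M"
    and b: "\<And>x. x \<in> topspace XE \<Longrightarrow> \<bar>f x\<bar> \<le> M"
  shows "\<exists>g. (\<lambda>x. complex_of_real (g x)) \<in> levels \<and> (\<forall>x\<in>topspace XE. \<bar>f x - g x\<bar> \<le> (2/3) ^ k * M)"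
proof (induction k)
  case 0
  have "(\<lambda>_. 0) \<in> cont_fun_on (\<Delta> 0) X"
    by (simp add: cont_fun_on_def cont_fun_def)
  then have "(\<lambda>_. complex_of_real 0) \<in> levels"
    using levelsI[of "\<lambda>_. 0" 0] by (simp add: lev_def)
  then show ?case
    using b by (intro exI[of _ "\<lambda>_. 0"]) auto
next
  case (Suc k)
  then obtain g where g: "(\<lambda>x. complex_of_real (g x)) \<in> levels"
    "\<And>x. x \<in> topspace XE \<Longrightarrow> \<bar>f x - g x\<bar> \<le> (2/3) ^ k * M" by blast
  \<comment> \<open>Only membership in \<open>levels\<close> is known of \<open>g\<close>; its
    continuity as a real function is recovered by taking real parts.\<close>
  have "(\<lambda>x. complex_of_real (g x)) \<in> cont_fun XE"
    using g(1) levels_cont_fun by blast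
  then have "continuous_map XE euclideanreal (\<lambda>x. Re (complex_of_real (g x)))"
    using continuous_map_Re unfolding cont_fun_def by blast
  with f have "continuous_map XE euclideanreal (\<lambda>x. f x - g x)"
    by (auto intro: continuous_map_diff)
  from levels_step[OF this _ g(2)] M
  obtain h where h: "(\<lambda>x. complex_of_real (h x)) \<in> levels"
    "\<And>x. x \<in> topspace XE \<Longrightarrow> \<bar>f x - g x - h x\<bar> \<le> 2/3 * ((2/3) ^ k * M)" by auto
  show ?case
    using levels_add[OF g(1) h(1)] h(2)
    by (intro exI[of _ "\<lambda>x. g x + h x"]) (simp add: algebra_simps)
qed

lemma levels_dense:
  assumes f: "f \<in> cont_fun XE" and e: "0 < e"
  shows "\<exists>g\<in>levels. \<forall>x. cmod (f x - g x) \<le> e"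
proof -
  obtain M where M: "M > 0" "\<And>x. cmod (f x) \<le> M"
    using cont_fun_bounded[OF compact_XE f] by blast
  have "(\<lambda>k. (2/3) ^ k * M) \<longlonglongrightarrow> 0 * M"
    by (intro tendsto_intros LIMSEQ_power_zero) simp
  then obtain k where k: "(2/3) ^ k * M < e / 2"
    using e order_tendstoD(2)[of "\<lambda>k. (2/3) ^ k * M" 0 sequentially "e/2"]
    by (auto simp: eventually_sequentially)
  have "continuous_map XE euclideanreal (\<lambda>x. Re (f x))" "continuous_map XE euclideanreal (\<lambda>x. Im (f x))"
    using f continuous_map_Re continuous_map_Im unfolding cont_fun_def by blast+
  note re = levels_approx_real[OF this(1) M(1), of k] and im = levels_approx_real[OF this(2) M(1), of k]
  obtain g where g: "(\<lambda>x. complex_of_real (g x)) \<in> levels" "\<And>x. x \<in> topspace XE \<Longrightarrow> \<bar>Re (f x) - g x\<bar> \<le> e/2"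
    using re order_trans[OF abs_Re_le_cmod M(2)] order_trans[OF _ less_imp_le[OF k]] by blast
  obtain h where h: "(\<lambda>x. complex_of_real (h x)) \<in> levels" "\<And>x. x \<in> topspace XE \<Longrightarrow> \<bar>Im (f x) - h x\<bar> \<le> e/2"
    using im order_trans[OF abs_Im_le_cmod M(2)] order_trans[OF _ less_imp_le[OF k]] by blast
  let ?l = "\<lambda>x. complex_of_real (g x) + \<i> * complex_of_real (h x)"
  have l: "?l \<in> levels"
    by (intro levels_add levels_scale g h)
  moreover have "cmod (f x - ?l x) \<le> e" for x
  proof (cases "x \<in> topspace XE")
    case True
    then show ?thesis
      using cmod_le[of "f x - ?l x"] g(2)[of x] h(2)[of x] by simp
  next
    case False
    then have "?l x = 0" "f x = 0"
      using l levels_cont_fun f by (auto simp: cont_fun_def)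
    then show ?thesis
      using e by simp
  qed
  ultimately show ?thesis
    by (intro bexI[of _ ?l]) blast
qed

end

section \<open>The extended representation\<close>

context surjective_partial_map
begin

definition one :: "'a set \<Rightarrow> 'a \<Rightarrow> complex" where
  "one K y = (if y \<in> K then 1 else 0)"

lemma one_Delta: "one (\<Delta> n) \<in> cont_fun_on (\<Delta> n) X"
  using indicator_cont_fun[OF Delta_clopen] by (simp add: one_def[abs_def])

lemma endo_one: "\<delta> (one (\<Delta> n)) = one (\<Delta> (Suc n))"
  by (auto simp: endo_def one_def Delta_Suc)

lemma one_mult: "a \<in> cont_fun_on (\<Delta> n) X \<Longrightarrow> (\<lambda>y. one (\<Delta> n) y * a y) = a"
  by (rule ext) (auto simp: one_def cont_fun_on_def cont_fun_def)

lemma cont_fun_on_Delta_antimono: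
  "m \<le> n \<Longrightarrow> a \<in> cont_fun_on (\<Delta> n) X \<Longrightarrow> a \<in> cont_fun_on (\<Delta> m) X"
  using Delta_antimono[of m n] by (auto simp: cont_fun_on_def)

section \<open>The shift on the extension and its endomorphism\<close>

abbreviation "DE \<equiv> Phi_preimage X D \<alpha> D"

lemma DE_clopen: "openin XE DE" "closedin XE DE"
  unfolding Phi_preimage_def Phi_def
  using openin_continuous_map_preimage[OF coord_continuous D_open]
    closedin_continuous_map_preimage[OF coord_continuous D_closed] by auto

lemma mem_DE_iff: "x \<in> DE \<longleftrightarrow> x \<in> topspace XE \<and> the (x 0) \<in> D"
  by (auto simp: Phi_preimage_def Phi_def)

lemma alpha_ext_simps: "alpha_ext \<alpha> x 0 = map_option \<alpha> (x 0)" "alpha_ext \<alpha> x (Suc n) = x n"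
  by (simp_all add: alpha_ext_def)

lemma alpha_ext_mem:
  assumes "x \<in> DE"
  shows "alpha_ext \<alpha> x \<in> topspace XE"
proof -
  have x: "x \<in> topspace XE" "the (x 0) \<in> D"
    using assms by (auto simp: mem_DE_iff)
  have "alpha_ext \<alpha> x n \<in> Some ` \<Delta> n" for n
  proof (cases n)
    case 0
    have "map_option \<alpha> (x 0) = Some (\<alpha> (the (x 0)))"
      by (subst XE_Some[OF x(1), of 0]) simp
    then show ?thesis
      using x(2) surj by (auto simp: 0 alpha_ext_simps Delta_0)
  next
    case (Suc m)
    \<comment> \<open>Prepending a coordinate moves entry \<open>m\<close> to index
      \<open>m + 1\<close>, so it must lie one \<open>\<Delta>\<close> deeper than before. The
      surplus is the assumption that entry 0 lies in \<open>D\<close>, carried upwards along the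
      sequence.\<close>
    have "the (x m) \<in> \<Delta> (Suc m)"
    proof (induction m)
      case 0
      then show ?case using x Delta_1 by simp
    next
      case (Suc j)
      then have "the (x (Suc j)) \<in> D"
        using XE_Delta[OF x(1), of "Suc j"] by (simp add: Delta_Suc)
      then show ?case
        using Suc XE_shift[OF x(1), of j] by (simp add: Delta_Suc[of "Suc j"])
    qed
    then show ?thesis
      using XE_Some[OF x(1), of m] by (simp add: Suc alpha_ext_simps)
  qed
  moreover have "map_option \<alpha> (alpha_ext \<alpha> x (Suc n)) = alpha_ext \<alpha> x n" for n
    using x(1) by (cases n) (simp_all add: alpha_ext_simps mem_XE_iff)
  ultimately show ?thesis
    by (simp add: mem_XE_iff)
qed

lemma continuous_map_alpha_ext: "continuous_map (subtopology XE DE) XE (alpha_ext \<alpha>)"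
proof -
  have p: "continuous_map XE (adjoin_point X) (\<lambda>x. x n)" for n
    unfolding XE_eq by (intro continuous_intros) simp
  have "continuous_map (subtopology XE DE) (adjoin_point X) (\<lambda>x. alpha_ext \<alpha> x n)" for n
  proof (cases n)
    case 0
    have "continuous_map (subtopology XE DE) (adjoin_point X)
        (\<lambda>x. if x 0 \<in> Some ` D then map_option \<alpha> (x 0) else None)"
      using continuous_map_compose[OF continuous_map_from_subtopology[OF p, of DE] continuous_map_alpha_option]
      by (simp only: comp_def)
    then show ?thesis
    proof (rule continuous_map_eq)
      fix x assume "x \<in> topspace (subtopology XE DE)"
      then have "x \<in> topspace XE" "the (x 0) \<in> D"
        by (auto simp: mem_DE_iff)
      then have "x 0 \<in> Some ` D"
        by (metis XE_Some image_eqI)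
      then show "(if x 0 \<in> Some ` D then map_option \<alpha> (x 0) else None) = alpha_ext \<alpha> x n"
        by (simp add: 0 alpha_ext_simps)
    qed
  next
    case (Suc m)
    then show ?thesis
      using continuous_map_from_subtopology[OF p] by (simp add: alpha_ext_simps)
  qed
  moreover have "alpha_ext \<alpha> \<in> topspace (subtopology XE DE) \<rightarrow> X_inf X D \<alpha>"
    using alpha_ext_mem topspace_XE by auto
  ultimately have "continuous_map (subtopology XE DE)
      (subtopology (product_topology (\<lambda>n. adjoin_point X) UNIV) (X_inf X D \<alpha>)) (alpha_ext \<alpha>)"
    by (simp only: continuous_map_in_subtopology continuous_map_componentwise_UNIV) blast
  then show ?thesis
    using XE_eq by metis
qed

lemma endo_lev_0: "endo DE (alpha_ext \<alpha>) (lev 0 a) = lev 0 (\<delta> a)"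
proof
  fix x
  show "endo DE (alpha_ext \<alpha>) (lev 0 a) x = lev 0 (\<delta> a) x"
    using alpha_ext_mem[of x] XE_Some[of x 0]
    by (cases "x 0") (auto simp: endo_def lev_def mem_DE_iff alpha_ext_simps)
qed

text \<open>The shift puts coordinate \<open>n\<close> at index \<open>n + 1\<close>, so composing
  with it lowers the level by one; the restriction to the domain of the shift survives as the factor
  \<open>one D\<close> at coordinate 0.\<close>

lemma endo_lev_Suc: "endo DE (alpha_ext \<alpha>) (lev (Suc n) a) = (\<lambda>x. lev 0 (one D) x * lev n a x)"
proof
  fix x
  show "endo DE (alpha_ext \<alpha>) (lev (Suc n) a) x = lev 0 (one D) x * lev n a x"
    using alpha_ext_mem[of x] by (auto simp: endo_def lev_def mem_DE_iff alpha_ext_simps one_def)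
qed

lemma bracket_eq: "bracket X D \<alpha> N a = (\<lambda>x. \<Sum>n\<le>N. lev n (a n) x)"
proof
  fix x
  show "bracket X D \<alpha> N a x = (\<Sum>n\<le>N. lev n (a n) x)"
  proof (cases "x \<in> topspace XE")
    case True
    have "(case x n of None \<Rightarrow> 0 | Some y \<Rightarrow> a n y) = lev n (a n) x" for n
      by (subst XE_Some[OF True, of n]) (simp add: lev_def True)
    with True show ?thesis
      by (simp add: bracket_def)
  qed (simp add: bracket_def lev_def)
qed

end

section \<open>The operators attached to the levels\<close>

locale surjective_covariant_rep = surjective_partial_map X D \<alpha>
  for X :: "'a topology" and D :: "'a set" and \<alpha> :: "'a \<Rightarrow> 'a" +
  fixes \<pi> :: "('a \<Rightarrow> complex) \<Rightarrow> ('h::chilbert_space \<Rightarrow> 'h)" and U :: "'h \<Rightarrow> 'h"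
  assumes CovRep: "(\<pi>, U) \<in> CovRep X D (\<alpha> ` D) (endo D \<alpha>)"
begin

lemma rep: "representation X \<pi>" and pisom: "partial_isometry U"
  and ini: "initial_space U = {\<pi> a h | a h. a \<in> cont_fun_on (topspace X) X}"
  and cov: "a \<in> cont_fun X \<Longrightarrow> U (\<pi> a (adj U h)) = \<pi> (\<delta> a) h"
  using CovRep unfolding CovRep_def surj by (auto simp: fun_eq_iff)

lemma U_ops: "U \<in> bounded_ops" "adj U \<in> bounded_ops" "U ^^ n \<in> bounded_ops" "adj U ^^ n \<in> bounded_ops"
  using pisom by (auto simp: partial_isometry_def adj_bounded_ops bounded_ops_funpow)

definition "P = \<pi> (one (\<Delta> 0))"

lemma one_cont_fun: "one (\<Delta> n) \<in> cont_fun X"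
  using one_Delta cont_fun_onD by blast

lemma rep_one_mult: "a \<in> cont_fun_on (\<Delta> n) X \<Longrightarrow> \<pi> (one (\<Delta> n)) (\<pi> a h) = \<pi> a h"
  using rep_mult[OF rep one_cont_fun cont_fun_onD, of a "\<Delta> n" n h] by (simp add: one_mult)

lemma rep_mult_one: "a \<in> cont_fun_on (\<Delta> n) X \<Longrightarrow> \<pi> a (\<pi> (one (\<Delta> n)) h) = \<pi> a h"
  using rep_mult[OF rep cont_fun_onD one_cont_fun, of a "\<Delta> n" n h] by (simp add: one_mult mult.commute[of "a _"])

lemma cont_fun_eq_Delta_0: "cont_fun_on (\<Delta> 0) X = cont_fun X"
  by (auto simp: cont_fun_on_def Delta_0)

text \<open>Since \<alpha> is onto, the initial space consists of all \<open>\<pi> a h\<close> with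
  \<open>a\<close> in the whole algebra, and these are fixed by the projection
  \<open>P = \<pi> 1\<close>. This identifies the product of \<open>adj U\<close> and
  \<open>U\<close> with \<open>P\<close>.\<close>

lemma P_ops: "P \<in> bounded_ops" and P_idem: "P (P h) = P h" and P_sa: "P x \<bullet> y = x \<bullet> P y"
  and P_range: "initial_space U = range P"
proof -
  show "P \<in> bounded_ops"
    unfolding P_def by (rule rep_bounded_ops[OF rep one_cont_fun])
  show "P (P h) = P h"
    unfolding P_def by (rule rep_one_mult[OF one_Delta])
  have "(\<lambda>y. cnj (one (\<Delta> 0) y)) = one (\<Delta> 0)"
    by (auto simp: one_def)
  then show "P x \<bullet> y = x \<bullet> P y"
    using rep_adj[OF rep one_cont_fun, of 0] inner_adj[OF rep_bounded_ops[OF rep one_cont_fun], of 0 x y]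
    by (simp add: P_def)
  have "\<pi> a h \<in> range P" if "a \<in> cont_fun_on (\<Delta> 0) X" for a h
    using rep_one_mult[OF that, of h] unfolding P_def by (metis rangeI)
  then show "initial_space U = range P"
    unfolding ini Delta_0[symmetric] using one_Delta[of 0] unfolding P_def by blast
qed

lemmas adj_U_U = partial_isometry_adj_comp(1)[OF pisom P_ops P_idem P_sa P_range]
  and U_P = partial_isometry_adj_comp(2)[OF pisom P_ops P_idem P_sa P_range]
  and U_norm = partial_isometry_adj_comp(3)[OF pisom P_ops P_idem P_sa P_range]

lemma adj_U_norm: "norm (adj U x) \<le> norm x"
  by (rule norm_adj_le[OF U_ops(1) U_norm])

text \<open>Covariance at the unit: \<open>U\<close> absorbs \<open>P\<close> on its right, and
  \<delta> sends the unit to the indicator of \<open>D\<close>.\<close>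

lemma U_adj_U: "U (adj U h) = \<pi> (one D) h"
proof -
  have "U (adj U h) = U (\<pi> (one (\<Delta> 0)) (adj U h))"
    using U_P[of "adj U h"] by (simp add: P_def)
  also have "\<dots> = \<pi> (one D) h"
    using cov[OF one_cont_fun[of 0], of h] by (simp add: endo_one Delta_1[simplified])
  finally show ?thesis .
qed

text \<open>Restricted to positive powers: at power 0 the left side would be \<open>h\<close> and
  the right side \<open>P h\<close>, which may differ as \<pi> need not be unital. In the induction
  the outermost \<open>U\<close> and the innermost \<open>adj U\<close> are split off, and
  covariance is applied to the indicator of \<open>\<Delta> (Suc n)\<close>.\<close>

lemma U_adj_U_funpow: "(U ^^ Suc n) ((adj U ^^ Suc n) h) = \<pi> (one (\<Delta> (Suc n))) h"
proof (induction n arbitrary: h)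
  case 0
  then show ?case
    using U_adj_U by (simp add: Delta_1[simplified])
next
  case (Suc n)
  have "(U ^^ Suc (Suc n)) ((adj U ^^ Suc (Suc n)) h) = U ((U ^^ Suc n) ((adj U ^^ Suc n) (adj U h)))"
    by (simp only: funpow.simps(2)[of "Suc n" U] funpow_Suc_right[of "Suc n" "adj U"] comp_apply)
  also have "\<dots> = \<pi> (one (\<Delta> (Suc (Suc n)))) h"
    unfolding Suc.IH using cov[OF one_cont_fun, of "Suc n" h] by (simp only: endo_one)
  finally show ?case .
qed

lemma U_adj_U_rep:
  assumes "a \<in> cont_fun_on (\<Delta> n) X"
  shows "(U ^^ n) ((adj U ^^ n) (\<pi> a h)) = \<pi> a h"
proof (cases n)
  case (Suc m)
  then show ?thesis
    using assms by (simp only: U_adj_U_funpow rep_one_mult)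
qed simp

definition level_rep :: "nat \<Rightarrow> ('a \<Rightarrow> complex) \<Rightarrow> 'h \<Rightarrow> 'h" where
  "level_rep n a h = (adj U ^^ n) (\<pi> a ((U ^^ n) h))"

lemma level_rep_lift:
  assumes a: "a \<in> cont_fun X"
  shows "level_rep (Suc n) (\<delta> a) = level_rep n a"
proof
  fix h
  have a0: "a \<in> cont_fun_on (\<Delta> 0) X"
    using a cont_fun_eq_Delta_0 by simp
  have "level_rep (Suc n) (\<delta> a) h = (adj U ^^ n) (adj U (\<pi> (\<delta> a) (U ((U ^^ n) h))))"
    unfolding level_rep_def by (simp only: funpow.simps(2)[of n U] funpow_Suc_right[of n "adj U"] comp_apply)
  also have "\<dots> = (adj U ^^ n) (P (\<pi> a (P ((U ^^ n) h))))"
    by (simp only: cov[OF a, symmetric] adj_U_U)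
  also have "\<dots> = level_rep n a h"
    using rep_one_mult[OF a0] rep_mult_one[OF a0] by (simp add: P_def level_rep_def)
  finally show "level_rep (Suc n) (\<delta> a) h = level_rep n a h" .
qed

lemma level_rep_lift_funpow:
  assumes "a \<in> cont_fun_on (\<Delta> n) X"
  shows "level_rep (k + n) ((\<delta> ^^ k) a) = level_rep n a"
proof (induction k)
  case (Suc k)
  then show ?case
    using level_rep_lift[OF cont_fun_onD[OF funpow_endo_cont_fun_on[OF assms, of k]], of "k + n"] by simp
qed simp

text \<open>Both coefficients are lifted to level \<open>m + n\<close>. There they represent the
  same function, hence coincide by \<open>lev_inj\<close>, while lifting does not change the
  operators.\<close>

lemma level_rep_well_defined:
  assumes a: "a \<in> cont_fun_on (\<Delta> n) X" and b: "b \<in> cont_fun_on (\<Delta> m) X" and eq: "lev n a = lev m b"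
  shows "level_rep n a = level_rep m b"
proof -
  have "lev (m + n) ((\<delta> ^^ m) a) = lev (m + n) ((\<delta> ^^ n) b)"
    using eq by (subst (2) add.commute) (simp only: lev_lift_funpow)
  moreover have "(\<delta> ^^ n) b \<in> cont_fun_on (\<Delta> (m + n)) X"
    using funpow_endo_cont_fun_on[OF b] by (subst add.commute)
  ultimately have "(\<delta> ^^ m) a = (\<delta> ^^ n) b"
    using lev_inj[OF funpow_endo_cont_fun_on[OF a]] by blast
  then show ?thesis
    using level_rep_lift_funpow[OF a, of m] level_rep_lift_funpow[OF b, of n] by (simp add: add.commute)
qed

definition levels_rep :: "((nat \<Rightarrow> 'a option) \<Rightarrow> complex) \<Rightarrow> 'h \<Rightarrow> 'h" where
  "levels_rep f = (SOME T. \<exists>n a. a \<in> cont_fun_on (\<Delta> n) X \<and> f = lev n a \<and> T = level_rep n a)"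

lemma levels_rep_lev:
  assumes "a \<in> cont_fun_on (\<Delta> n) X"
  shows "levels_rep (lev n a) = level_rep n a"
proof -
  have "\<exists>T m b. b \<in> cont_fun_on (\<Delta> m) X \<and> lev n a = lev m b \<and> T = level_rep m b"
    using assms by blast
  from someI_ex[OF this] show ?thesis
    unfolding levels_rep_def[symmetric] using level_rep_well_defined[OF assms] by metis
qed

lemma level_rep_add:
  assumes "a \<in> cont_fun X" "b \<in> cont_fun X"
  shows "level_rep n (\<lambda>y. a y + b y) h = level_rep n a h + level_rep n b h"
  by (simp add: level_rep_def rep_add[OF rep assms] bounded_ops_add[OF U_ops(4)])

lemma level_rep_scale:
  assumes "a \<in> cont_fun X"
  shows "level_rep n (\<lambda>y. c * a y) h = c *\<^sub>C level_rep n a h"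
  by (simp add: level_rep_def rep_scale[OF rep assms] bounded_ops_scaleC[OF U_ops(4)])

text \<open>Between \<open>\<pi> a\<close> and \<open>\<pi> b\<close> stands the product of
  \<open>U ^^ n\<close> and \<open>adj U ^^ n\<close>, which acts trivially on the range of
  \<open>\<pi> b\<close> because \<open>b\<close> is supported in \<open>\<Delta> n\<close>.\<close>

lemma level_rep_mult:
  assumes a: "a \<in> cont_fun X" and b: "b \<in> cont_fun_on (\<Delta> n) X"
  shows "level_rep n (\<lambda>y. a y * b y) h = level_rep n a (level_rep n b h)"
  by (simp add: level_rep_def rep_mult[OF rep a cont_fun_onD[OF b]] U_adj_U_rep[OF b])

lemma level_rep_ops:
  assumes "a \<in> cont_fun X"
  shows "level_rep n a \<in> bounded_ops"
  unfolding level_rep_def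
  by (intro bounded_ops_comp[OF U_ops(4)] bounded_ops_comp[OF rep_bounded_ops[OF rep assms]]) (rule U_ops(3))

lemma level_rep_cnj:
  assumes a: "a \<in> cont_fun X"
  shows "level_rep n (\<lambda>y. cnj (a y)) h \<bullet> k = h \<bullet> level_rep n a k"
proof -
  have "level_rep n (\<lambda>y. cnj (a y)) h \<bullet> k = (U ^^ n) h \<bullet> \<pi> a ((U ^^ n) k)"
    by (simp add: level_rep_def inner_adj_funpow[OF U_ops(1)] rep_adj[OF rep a] inner_adj[OF rep_bounded_ops[OF rep a]])
  also have "\<dots> = h \<bullet> level_rep n a k"
    unfolding level_rep_def
    by (metis inner_adj_funpow[OF U_ops(1)] inner_commute)
  finally show ?thesis .
qed

lemma level_rep_bound:
  assumes "a \<in> cont_fun X" and s: "\<And>y. cmod (a y) \<le> s"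
  shows "norm (level_rep n a h) \<le> s * norm h"
proof -
  have "norm (level_rep n a h) \<le> norm (\<pi> a ((U ^^ n) h))"
    unfolding level_rep_def by (rule norm_funpow_le[OF adj_U_norm])
  also have "\<dots> \<le> s * norm ((U ^^ n) h)"
    by (rule rep_contractive[OF rep assms])
  also have "\<dots> \<le> s * norm h"
    by (intro mult_left_mono norm_funpow_le U_norm order_trans[OF norm_ge_zero s])
  finally show ?thesis .
qed

lemma exists_rep:
  "\<exists>\<rho>. representation XE \<rho> \<and> (\<forall>n. \<forall>a\<in>cont_fun_on (\<Delta> n) X. \<rho> (lev n a) = level_rep n a)"
proof -
  have "\<exists>\<rho>. representation XE \<rho> \<and> (\<forall>f\<in>levels. \<rho> f = levels_rep f)"
  proof (rule representation_extend[OF compact_XE levels_cont_fun])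
    fix f g :: "(nat \<Rightarrow> 'a option) \<Rightarrow> complex" and h k :: 'h and c :: complex and e s :: real
    show "f \<in> cont_fun XE \<Longrightarrow> 0 < e \<Longrightarrow> \<exists>g\<in>levels. \<forall>y. cmod (f y - g y) \<le> e"
      by (rule levels_dense)
    assume f: "f \<in> levels"
    show "(\<lambda>y. c * f y) \<in> levels" "(\<lambda>y. cnj (f y)) \<in> levels"
      using f by (rule levels_scale levels_cnj)+
    obtain n a where fa: "f = lev n a" "a \<in> cont_fun_on (\<Delta> n) X"
      using f by (auto simp: levels_def)
    note a = cont_fun_onD[OF fa(2)]
    show "levels_rep f \<in> bounded_ops"
      using level_rep_ops[OF a] by (simp add: fa levels_rep_lev)
    show "levels_rep (\<lambda>y. c * f y) h = c *\<^sub>C levels_rep f h"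
      by (simp add: fa levels_rep_lev cont_fun_on_scale level_rep_scale[OF a] flip: lev_scale)
    show "levels_rep (\<lambda>y. cnj (f y)) h \<bullet> k = h \<bullet> levels_rep f k"
      by (simp add: fa levels_rep_lev cont_fun_on_cnj level_rep_cnj[OF a] flip: lev_cnj)
    show "norm (levels_rep f h) \<le> s * norm h" if "\<And>y. cmod (f y) \<le> s"
      unfolding fa(1) levels_rep_lev[OF fa(2)]
      by (rule level_rep_bound[OF a lev_bound[OF fa(2)]]) (use that fa in simp)
  next
    fix f g :: "(nat \<Rightarrow> 'a option) \<Rightarrow> complex" and h :: 'h
    assume f: "f \<in> levels" and g: "g \<in> levels"
    then show "(\<lambda>y. f y + g y) \<in> levels" "(\<lambda>y. f y * g y) \<in> levels"
      by (rule levels_add levels_mult)+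
    obtain n a b where fg: "f = lev n a" "g = lev n b"
      and ab: "a \<in> cont_fun_on (\<Delta> n) X" "b \<in> cont_fun_on (\<Delta> n) X"
      using f g by (rule levels_common)
    note a = cont_fun_onD[OF ab(1)] and b = cont_fun_onD[OF ab(2)]
    show "levels_rep (\<lambda>y. f y + g y) h = levels_rep f h + levels_rep g h"
      by (simp add: fg ab levels_rep_lev cont_fun_on_add level_rep_add[OF a b] flip: lev_add)
    show "levels_rep (\<lambda>y. f y * g y) h = levels_rep f (levels_rep g h)"
      by (simp add: fg ab b levels_rep_lev cont_fun_on_mult level_rep_mult[OF a ab(2)] flip: lev_mult)
  qed
  then obtain \<rho> where "representation XE \<rho>" "\<And>f. f \<in> levels \<Longrightarrow> \<rho> f = levels_rep f"
    by blast
  then show ?thesis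
    using levels_rep_lev levelsI by (intro exI[of _ \<rho>]) auto
qed

section \<open>Covariance of the extended representation\<close>

context
  fixes \<rho> :: "((nat \<Rightarrow> 'a option) \<Rightarrow> complex) \<Rightarrow> 'h \<Rightarrow> 'h"
  assumes \<rho>: "representation XE \<rho>" and \<rho>_lev: "\<And>n a. a \<in> cont_fun_on (\<Delta> n) X \<Longrightarrow> \<rho> (lev n a) = level_rep n a"
begin

lemma one_D: "one D \<in> cont_fun_on (\<Delta> 0) X"
  using cont_fun_on_Delta_antimono[of 0 1, OF _ one_Delta[of 1]] by (simp add: Delta_1[simplified])

lemma ext_one_D: "\<rho> (lev 0 (one D)) h = U (adj U h)"
  by (simp add: \<rho>_lev[OF one_D] level_rep_def U_adj_U)

text \<open>At level 0 this is the covariance of \<pi>. At level \<open>m + 1\<close> the outer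
  \<open>U\<close> and \<open>adj U\<close> meet the extreme factors of
  \<open>level_rep (Suc m) a\<close>, leaving \<open>level_rep m a\<close> between two copies of
  \<rho> at the indicator of \<open>DE\<close>. That function is idempotent, so the two copies merge
  into the factor of \<open>endo_lev_Suc\<close>.\<close>

lemma ext_cov_lev:
  assumes a: "a \<in> cont_fun_on (\<Delta> n) X"
  shows "U (\<rho> (lev n a) (adj U h)) = \<rho> (endo DE (alpha_ext \<alpha>) (lev n a)) h"
proof (cases n)
  case 0
  have "\<delta> a \<in> cont_fun_on (\<Delta> 0) X"
    using endo_cont_fun_on[OF a] by (rule cont_fun_on_Delta_antimono[rotated]) simp
  then show ?thesis
    using a cov[OF cont_fun_onD[OF a]] by (simp add: 0 endo_lev_0 \<rho>_lev level_rep_def)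
next
  case (Suc m)
  have am: "a \<in> cont_fun_on (\<Delta> m) X"
    using a by (rule cont_fun_on_Delta_antimono[rotated]) (simp add: Suc)
  have c: "lev 0 (one D) \<in> cont_fun XE" "lev m a \<in> cont_fun XE"
    using lev_cont_fun cont_fun_onD one_D am by blast+
  have "U (\<rho> (lev n a) (adj U h)) = U (level_rep (Suc m) a (adj U h))"
    using \<rho>_lev a by (simp add: Suc)
  also have "\<dots> = U (adj U (level_rep m a (U (adj U h))))"
    unfolding level_rep_def by (simp only: funpow.simps(2)[of m "adj U"] funpow_Suc_right[of m U] comp_apply)
  also have "\<dots> = \<rho> (lev 0 (one D)) (\<rho> (lev m a) (\<rho> (lev 0 (one D)) h))"
    by (simp only: ext_one_D \<rho>_lev[OF am])
  also have "\<dots> = \<rho> (\<lambda>x. lev 0 (one D) x * (lev m a x * lev 0 (one D) x)) h"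
    by (simp only: rep_mult[OF \<rho>] c cont_fun_mult)
  also have "(\<lambda>x. lev 0 (one D) x * (lev m a x * lev 0 (one D) x)) = (\<lambda>x. lev 0 (one D) x * lev m a x)"
    by (auto simp: lev_def one_def)
  finally show ?thesis
    by (simp add: Suc endo_lev_Suc)
qed

lemma ext_endo_cont_fun: "f \<in> cont_fun XE \<Longrightarrow> endo DE (alpha_ext \<alpha>) f \<in> cont_fun XE"
  by (rule endo_cont_fun[OF DE_clopen continuous_map_alpha_ext])

text \<open>Approximating \<open>f\<close> within \<open>e\<close> by a level function moves each
  side by at most \<open>e * norm h\<close>, because \<rho>, \<open>U\<close> and
  \<open>adj U\<close> are contractive, and for level functions the sides agree.\<close>

lemma ext_cov:
  assumes f: "f \<in> cont_fun XE"
  shows "U (\<rho> f (adj U h)) = \<rho> (endo DE (alpha_ext \<alpha>) f) h"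
proof -
  let ?d = "endo DE (alpha_ext \<alpha>)"
  have le: "norm (U (\<rho> f (adj U h)) - \<rho> (?d f) h) \<le> e * (2 * norm h)" if "e > 0" for e
  proof -
    obtain n a where a: "a \<in> cont_fun_on (\<Delta> n) X" and e: "\<And>x. cmod (f x - lev n a x) \<le> e"
      using levels_dense[OF f \<open>e > 0\<close>] by (auto simp: levels_def)
    define g where "g = lev n a"
    have g: "g \<in> cont_fun XE"
      unfolding g_def by (rule lev_cont_fun[OF cont_fun_onD[OF a]])
    have "norm (U (\<rho> (\<lambda>x. f x - g x) (adj U h))) \<le> norm (\<rho> (\<lambda>x. f x - g x) (adj U h))"
      by (rule U_norm)
    also have "\<dots> \<le> e * norm (adj U h)"
      by (rule rep_contractive[OF \<rho> cont_fun_diff[OF f g]]) (simp add: g_def e)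
    also have "\<dots> \<le> e * norm h"
      using \<open>e > 0\<close> adj_U_norm[of h] by (intro mult_left_mono) auto
    finally have 1: "norm (U (\<rho> f (adj U h)) - U (\<rho> g (adj U h))) \<le> e * norm h"
      by (simp add: rep_diff[OF \<rho> f g] bounded_ops_diff[OF U_ops(1)])
    have "norm (\<rho> (\<lambda>x. ?d f x - ?d g x) h) \<le> e * norm h"
      by (rule rep_contractive[OF \<rho> cont_fun_diff[OF ext_endo_cont_fun[OF f] ext_endo_cont_fun[OF g]]])
        (use e \<open>e > 0\<close> in \<open>simp add: endo_def g_def\<close>)
    then have 2: "norm (\<rho> (?d f) h - \<rho> (?d g) h) \<le> e * norm h"
      by (simp add: rep_diff[OF \<rho> ext_endo_cont_fun[OF f] ext_endo_cont_fun[OF g]])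
    have "U (\<rho> g (adj U h)) = \<rho> (?d g) h"
      unfolding g_def by (rule ext_cov_lev[OF a])
    then have "norm (U (\<rho> f (adj U h)) - \<rho> (?d f) h) =
        norm ((U (\<rho> f (adj U h)) - U (\<rho> g (adj U h))) - (\<rho> (?d f) h - \<rho> (?d g) h))"
      by simp
    also have "\<dots> \<le> e * norm h + e * norm h"
      by (rule order_trans[OF norm_triangle_ineq4 add_mono[OF 1 2]])
    finally show ?thesis by simp
  qed
  have "norm (U (\<rho> f (adj U h)) - \<rho> (?d f) h) \<le> 0 + e" if "e > 0" for e
  proof -
    have "2 * norm h + 1 > 0" by (simp add: add_nonneg_pos)
    then have "norm (U (\<rho> f (adj U h)) - \<rho> (?d f) h) \<le> e / (2 * norm h + 1) * (2 * norm h)"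
      using that by (intro le) simp
    also have "\<dots> \<le> e / (2 * norm h + 1) * (2 * norm h + 1)"
      using that by (intro mult_left_mono) auto
    also have "\<dots> = e"
      using \<open>2 * norm h + 1 > 0\<close> by simp
    finally show ?thesis by simp
  qed
  then have "norm (U (\<rho> f (adj U h)) - \<rho> (?d f) h) \<le> 0"
    by (rule field_le_epsilon)
  then show ?thesis by simp
qed

text \<open>The initial and final projections of \<open>U\<close> are the values of \<rho> at the
  unit and at the indicator of \<open>DE\<close>. A function supported in a set is fixed by
  multiplication with its indicator, which turns these ranges into the spaces required.\<close>

lemma ext_CovRep:
  "(\<rho>, U) \<in> CovRep XE DE (Phi_preimage X D \<alpha> (\<alpha> ` D)) (endo DE (alpha_ext \<alpha>))"
proof -
  have E: "Phi_preimage X D \<alpha> (\<alpha> ` D) = topspace XE"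
    using XE_Delta[of _ 0] by (auto simp: Phi_preimage_def Phi_def surj Delta_0)
  have one: "lev 0 (one (\<Delta> 0)) \<in> cont_fun XE" "lev 0 (one D) \<in> cont_fun XE"
    using lev_cont_fun cont_fun_onD one_D one_Delta by blast+
  have P: "\<rho> (lev 0 (one (\<Delta> 0))) = P"
    by (auto simp: \<rho>_lev[OF one_Delta] level_rep_def P_def)
  have i1: "\<rho> f h \<in> range P" if "f \<in> cont_fun XE" for f h
  proof -
    have "(\<lambda>x. lev 0 (one (\<Delta> 0)) x * f x) = f"
      using that XE_Delta[of _ 0] by (auto simp: lev_def one_def cont_fun_def)
    then show ?thesis
      using rep_mult[OF \<rho> one(1) that, of h] by (simp add: P)
  qed
  have "P h \<in> {\<rho> f h | f h. f \<in> cont_fun XE}" for h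
    using one(1) unfolding P[symmetric] by blast
  with i1 have init: "initial_space U = {\<rho> f h | f h. f \<in> cont_fun_on (topspace XE) XE}"
    unfolding P_range by (auto simp: cont_fun_on_def)
  have f1: "\<rho> f h \<in> range U" if "f \<in> cont_fun_on DE XE" for f h
  proof -
    have "(\<lambda>x. lev 0 (one D) x * f x) = f"
      using that by (auto simp: lev_def one_def cont_fun_on_def cont_fun_def mem_DE_iff)
    then show ?thesis
      using rep_mult[OF \<rho> one(2) cont_fun_onD[OF that], of h] by (simp add: ext_one_D)
  qed
  have "lev 0 (one D) \<in> cont_fun_on DE XE"
    using one(2) by (auto simp: cont_fun_on_def lev_def one_def mem_DE_iff)
  moreover have "U h = \<rho> (lev 0 (one D)) (U h)" for h
    by (simp add: ext_one_D adj_U_U U_P)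
  ultimately have "U h \<in> {\<rho> f h | f h. f \<in> cont_fun_on DE XE}" for h
    by blast
  with f1 have fin: "final_space U = {\<rho> f h | f h. f \<in> cont_fun_on DE XE}"
    unfolding final_space_def by auto
  show ?thesis
    unfolding CovRep_def E using \<rho> pisom init fin ext_cov by (simp add: fun_eq_iff)
qed

lemma ext_bracket:
  assumes "\<forall>n\<le>N. a n \<in> cont_fun_on (\<Delta> n) X"
  shows "\<rho> (bracket X D \<alpha> N a) = (\<lambda>h. \<Sum>n\<le>N. (adj U ^^ n) (\<pi> (a n) ((U ^^ n) h)))"
proof -
  \<comment> \<open>Membership of the partial sums is carried through the induction, since
    additivity of \<rho> is available on \<open>cont_fun XE\<close> only.\<close>
  have "(\<lambda>x. \<Sum>n\<le>N. lev n (a n) x) \<in> cont_fun XE \<and>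
      \<rho> (\<lambda>x. \<Sum>n\<le>N. lev n (a n) x) = (\<lambda>h. \<Sum>n\<le>N. level_rep n (a n) h)"
    using assms
  proof (induction N)
    case 0
    then show ?case
      using lev_cont_fun[OF cont_fun_onD, of "a 0"] by (simp add: \<rho>_lev)
  next
    case (Suc N)
    then have a: "a (Suc N) \<in> cont_fun_on (\<Delta> (Suc N)) X" by simp
    show ?case
      using Suc cont_fun_add rep_add[OF \<rho>] lev_cont_fun[OF cont_fun_onD[OF a], of "Suc N"]
      by (auto simp: fun_eq_iff \<rho>_lev[OF a])
  qed
  then show ?thesis
    by (simp add: bracket_eq level_rep_def)
qed

end

end

theorem theorem3p14:
  fixes X :: "'a topology" and \<Delta>\<^sub>1 :: "'a set" and \<alpha> :: "'a \<Rightarrow> 'a"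
    and \<pi> :: "('a \<Rightarrow> complex) \<Rightarrow> ('h::chilbert_space \<Rightarrow> 'h)" and U :: "'h \<Rightarrow> 'h"
  assumes "compact_space X" and "Hausdorff_space X"
    and "openin X \<Delta>\<^sub>1" and "closedin X \<Delta>\<^sub>1"
    and "continuous_map (subtopology X \<Delta>\<^sub>1) X \<alpha>"
    and "openin X (\<alpha> ` \<Delta>\<^sub>1)"
    and "inj_on (endo \<Delta>\<^sub>1 \<alpha>) (cont_fun X)"
    and "(\<pi>, U) \<in> CovRep X \<Delta>\<^sub>1 (\<alpha> ` \<Delta>\<^sub>1) (endo \<Delta>\<^sub>1 \<alpha>)"
  shows "\<exists>\<rho>. (\<rho>, U) \<in> CovRep (X_ext X \<Delta>\<^sub>1 \<alpha>)
             (Phi_preimage X \<Delta>\<^sub>1 \<alpha> \<Delta>\<^sub>1) (Phi_preimage X \<Delta>\<^sub>1 \<alpha> (\<alpha> ` \<Delta>\<^sub>1))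
             (endo (Phi_preimage X \<Delta>\<^sub>1 \<alpha> \<Delta>\<^sub>1) (alpha_ext \<alpha>)) \<and>
           (\<forall>N a. (\<forall>n\<le>N. a n \<in> cont_fun_on (Delta X \<Delta>\<^sub>1 \<alpha> n) X) \<longrightarrow>
             \<rho> (bracket X \<Delta>\<^sub>1 \<alpha> N a) = (\<lambda>h. \<Sum>n\<le>N. (adj U ^^ n) (\<pi> (a n) ((U ^^ n) h))))"
proof -
  interpret surjective_covariant_rep X \<Delta>\<^sub>1 \<alpha> \<pi> U
    by unfold_locales (use assms surj_if_inj_endo[OF assms(1-7)] in auto)
  obtain \<rho> where \<rho>: "representation XE \<rho>"
    "\<And>n a. a \<in> cont_fun_on (\<Delta> n) X \<Longrightarrow> \<rho> (lev n a) = level_rep n a"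
    using exists_rep by blast
  show ?thesis
    using ext_CovRep[OF \<rho>] ext_bracket[OF \<rho>] by blast
qed

end
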